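(* Let $n\in\mathbb N$ and $f\in\mathcal D^n$. If for every $j\in\{1,\dots,n-1\}$ the function $(f_{j+1}-f_j)^+$ is unbounded on $[0,\infty)$, then $f\in\mathcal D^n_\downarrow$.
   Context: $\mathcal D^n$ is the set of $f=(f_1,\dots,f_n)$ where each $f_i:[0,\infty)\to\mathbb R$ is cadlag (right-continuous with left limits), has no negative jumps ($f_i(x)\ge f_i(x^-)$ for all $x$), and $f_i(0)\ge 0$; by convention $f_i(0^-)=0$. Each $f$ defines a finitely additive signed measure $df$ on $[0,\infty)\times\{1,\dots,n\}$ by $df([x,y]\times\{i\})=f_i(y)-f_i(x^-)$. $a^+=\max(a,0)$. A path from $(x,n)$ to $(y,1)$, $0\le x\le y$, is a set $\pi=\bigcup_{i=1}^{n}[t_i,t_{i-1}]\times\{i\}$ with $x=t_n\le t_{n-1}\le\dots\le t_1\le t_0=y$. Two paths are essentially disjoint if their intersection is finite. A path $\pi$ is to the left of a path $\rho$ if for all $(x,\ell)\in\pi$, $(y,m)\in\rho$ we have $\ell\le m$ or $x\le y$. $f[(0,n)^k\to(t,1)^k]=\sup df(\pi_1\cup\dots\cup\pi_k)$ over $k$-tuples of pairwise essentially disjoint paths from $(0,n)$ to $(t,1)$. For $1\le k\le n$, a $k$-disjoint optimizer from $(0,n)$ to $(t,1)$ is a $k$-tuple $(\pi_1,\dots,\pi_k)$ of pairwise essentially disjoint paths from $(0,n)$ to $(t,1)$, with $\pi_i$ to the left of $\pi_j$ for $i<j$, attaining this supremum. $\mathcal D^n_{\downarrow-}$ is the set of $f\in\mathcal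 D^n$ such that for every $k\in\{1,\dots,n\}$ there are times $t_m\to\infty$ and $k$-disjoint optimizers $(\pi^m_1,\dots,\pi^m_k)$ from $(0,n)$ to $(t_m,1)$ converging locally to the $k$ lowest constant paths, i.e. for every $T>0$, for all sufficiently large $m$, $[0,T]\times\{n-k+i\}\subset\pi^m_i$ for all $i=1,\dots,k$. $\mathcal D^n_\downarrow$ is the closure of $\mathcal D^n_{\downarrow-}$ in $\mathcal D^n$ in the topology of uniform convergence on $[0,\infty)\times\{1,\dots,n\}$. *)

theory Defs
  imports "HOL-Analysis.Analysis"
begin

text \<open>
  A tuple \<open>(f\<^sub>1,\<dots>,f\<^sub>n)\<close> of functions on \<open>[0,\<infinity>)\<close> is an \<open>f :: nat \<Rightarrow> real \<Rightarrow> real\<close> of which only the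
  values \<open>f i x\<close> with \<open>i \<in> {1..n}\<close> and \<open>x \<ge> 0\<close> matter; no definition below depends on the others.
\<close>

text \<open>\<open>g(x\<^sup>-)\<close>, with the convention \<open>g(0\<^sup>-) = 0\<close>.\<close>
definition left_lim :: "(real \<Rightarrow> real) \<Rightarrow> real \<Rightarrow> real" where
  "left_lim g x = (if x = 0 then 0 else Lim (at_left x) g)"

definition cadlag :: "(real \<Rightarrow> real) \<Rightarrow> bool" where
  "cadlag g \<longleftrightarrow> (\<forall>x\<ge>0. continuous (at_right x) g) \<and> (\<forall>x>0. \<exists>l. (g \<longlongrightarrow> l) (at_left x))"

definition Dspace :: "nat \<Rightarrow> (nat \<Rightarrow> real \<Rightarrow> real) set" where
  "Dspace n = {f. \<forall>i\<in>{1..n}. cadlag (f i) \<and> (\<forall>x\<ge>0. left_lim (f i) x \<le> f i x) \<and> 0 \<le> f i 0}"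

text \<open>
  The finitely additive signed measure \<open>df\<close>, on finite unions \<open>A\<close> of sets \<open>[x,y] \<times> {i}\<close>.  The section of
  such an \<open>A\<close> on line \<open>i\<close> is the disjoint union of its finitely many connected components, which are
  compact intervals (possibly single points) \<open>[Inf C, Sup C]\<close>; so the value below is the one forced by
  finite additivity and \<open>df([x,y] \<times> {i}) = f\<^sub>i(y) - f\<^sub>i(x\<^sup>-)\<close>.
\<close>
definition df :: "nat \<Rightarrow> (nat \<Rightarrow> real \<Rightarrow> real) \<Rightarrow> (real \<times> nat) set \<Rightarrow> real" where
  "df n f A = (\<Sum>i\<in>{1..n}. \<Sum>C\<in>components {x. (x, i) \<in> A}. f i (Sup C) - left_lim (f i) (Inf C))"

lemma df_interval:
  assumes "i \<in> {1..n}" "x \<le> y"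
  shows "df n f ({x..y} \<times> {i}) = f i y - left_lim (f i) x"
proof -
  have "(\<Sum>C\<in>components {z. (z, j) \<in> {x..y} \<times> {i}}. f j (Sup C) - left_lim (f j) (Inf C))
      = (if j = i then f i y - left_lim (f i) x else 0)" for j
  proof (cases "j = i")
    case True
    have "components {x..y} = {{x..y}}"
      using assms(2) by (subst components_eq_sing_iff) auto
    moreover have "{z. (z, j) \<in> {x..y} \<times> {i}} = {x..y}" using True by auto
    ultimately show ?thesis using True assms(2) by simp
  qed auto
  then show ?thesis using assms(1) by (simp add: df_def)
qed

definition is_path :: "nat \<Rightarrow> real \<Rightarrow> real \<Rightarrow> (real \<times> nat) set \<Rightarrow> bool" where
  "is_path n x y \<pi> \<longleftrightarrow> 0 \<le> x \<and> x \<le> y \<and>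
     (\<exists>t. t n = x \<and> t 0 = y \<and> (\<forall>i\<in>{1..n}. t i \<le> t (i - 1)) \<and>
          \<pi> = (\<Union>i\<in>{1..n}. {t i..t (i - 1)} \<times> {i}))"

definition essentially_disjoint :: "(real \<times> nat) set \<Rightarrow> (real \<times> nat) set \<Rightarrow> bool" where
  "essentially_disjoint \<pi> \<rho> \<longleftrightarrow> finite (\<pi> \<inter> \<rho>)"

definition left_of :: "(real \<times> nat) set \<Rightarrow> (real \<times> nat) set \<Rightarrow> bool" where
  "left_of \<pi> \<rho> \<longleftrightarrow> (\<forall>(x, l)\<in>\<pi>. \<forall>(y, m)\<in>\<rho>. l \<le> m \<or> x \<le> y)"

text \<open>
  A \<open>k\<close>-tuple \<open>(\<pi>\<^sub>1,\<dots>,\<pi>\<^sub>k)\<close> is a function \<open>p\<close> of which only \<open>p 1, \<dots>, p k\<close> matter.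
\<close>
definition disjoint_paths :: "nat \<Rightarrow> nat \<Rightarrow> real \<Rightarrow> (nat \<Rightarrow> (real \<times> nat) set) \<Rightarrow> bool" where
  "disjoint_paths n k t p \<longleftrightarrow> (\<forall>i\<in>{1..k}. is_path n 0 t (p i)) \<and>
     (\<forall>i\<in>{1..k}. \<forall>j\<in>{1..k}. i \<noteq> j \<longrightarrow> essentially_disjoint (p i) (p j))"

text \<open>
  \<open>f[(0,n)\<^sup>k \<rightarrow> (t,1)\<^sup>k]\<close>.  For \<open>f \<in> Dspace n\<close>, \<open>1 \<le> k \<le> n\<close> and \<open>t \<ge> 0\<close> the supremum is over a nonempty
  bounded set, since cadlag functions are bounded on \<open>[0,t]\<close>.
\<close>
definition last_passage :: "nat \<Rightarrow> (nat \<Rightarrow> real \<Rightarrow> real) \<Rightarrow> nat \<Rightarrow> real \<Rightarrow> real" where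
  "last_passage n f k t = (SUP p\<in>{p. disjoint_paths n k t p}. df n f (\<Union>i\<in>{1..k}. p i))"

definition disjoint_optimizer ::
  "nat \<Rightarrow> (nat \<Rightarrow> real \<Rightarrow> real) \<Rightarrow> nat \<Rightarrow> real \<Rightarrow> (nat \<Rightarrow> (real \<times> nat) set) \<Rightarrow> bool" where
  "disjoint_optimizer n f k t p \<longleftrightarrow> disjoint_paths n k t p \<and>
     (\<forall>i\<in>{1..k}. \<forall>j\<in>{1..k}. i < j \<longrightarrow> left_of (p i) (p j)) \<and>
     df n f (\<Union>i\<in>{1..k}. p i) = last_passage n f k t"

definition Dspace_down_minus :: "nat \<Rightarrow> (nat \<Rightarrow> real \<Rightarrow> real) set" where
  "Dspace_down_minus n = {f \<in> Dspace n. \<forall>k\<in>{1..n}.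
     \<exists>(t :: nat \<Rightarrow> real) (p :: nat \<Rightarrow> nat \<Rightarrow> (real \<times> nat) set).
       filterlim t at_top sequentially \<and>
       (\<forall>m. disjoint_optimizer n f k (t m) (p m)) \<and>
       (\<forall>T>0. \<forall>\<^sub>F m in sequentially. \<forall>i\<in>{1..k}. {0..T} \<times> {n - k + i} \<subseteq> p m i)}"

definition uniform_open :: "nat \<Rightarrow> (nat \<Rightarrow> real \<Rightarrow> real) set \<Rightarrow> bool" where
  "uniform_open n U \<longleftrightarrow> U \<subseteq> Dspace n \<and>
     (\<forall>f\<in>U. \<exists>\<epsilon>>0. \<forall>g\<in>Dspace n. (\<forall>i\<in>{1..n}. \<forall>x\<ge>0. \<bar>f i x - g i x\<bar> < \<epsilon>) \<longrightarrow> g \<in> U)"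

lemma istopology_uniform_open: "istopology (uniform_open n)"
  unfolding istopology_def
proof (intro conjI allI impI)
  fix S T assume S: "uniform_open n S" and T: "uniform_open n T"
  show "uniform_open n (S \<inter> T)"
    unfolding uniform_open_def
  proof (intro conjI ballI)
    show "S \<inter> T \<subseteq> Dspace n" using S unfolding uniform_open_def by auto
    fix f assume f: "f \<in> S \<inter> T"
    obtain a where a: "a > 0"
      "\<And>g. g \<in> Dspace n \<Longrightarrow> (\<forall>i\<in>{1..n}. \<forall>x\<ge>0. \<bar>f i x - g i x\<bar> < a) \<Longrightarrow> g \<in> S"
      using S f unfolding uniform_open_def by (metis IntD1)
    obtain b where b: "b > 0"
      "\<And>g. g \<in> Dspace n \<Longrightarrow> (\<forall>i\<in>{1..n}. \<forall>x\<ge>0. \<bar>f i x - g i x\<bar> < b) \<Longrightarrow> g \<in> T"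
      using T f unfolding uniform_open_def by (metis IntD2)
    show "\<exists>\<epsilon>>0. \<forall>g\<in>Dspace n. (\<forall>i\<in>{1..n}. \<forall>x\<ge>0. \<bar>f i x - g i x\<bar> < \<epsilon>) \<longrightarrow> g \<in> S \<inter> T"
      by (rule exI[of _ "min a b"]) (use a b in auto)
  qed
next
  fix K assume K: "\<forall>S\<in>K. uniform_open n S"
  show "uniform_open n (\<Union>K)"
    unfolding uniform_open_def
  proof (intro conjI ballI)
    show "\<Union>K \<subseteq> Dspace n" using K unfolding uniform_open_def by auto
    fix f assume "f \<in> \<Union>K"
    then obtain S where S: "S \<in> K" "f \<in> S" by auto
    then obtain a where "a > 0"
      "\<forall>g\<in>Dspace n. (\<forall>i\<in>{1..n}. \<forall>x\<ge>0. \<bar>f i x - g i x\<bar> < a) \<longrightarrow> g \<in> S"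
      using K unfolding uniform_open_def by meson
    then show "\<exists>\<epsilon>>0. \<forall>g\<in>Dspace n. (\<forall>i\<in>{1..n}. \<forall>x\<ge>0. \<bar>f i x - g i x\<bar> < \<epsilon>) \<longrightarrow> g \<in> \<Union>K"
      using S(1) by blast
  qed
qed

text \<open>The topology of uniform convergence on \<open>[0,\<infinity>) \<times> {1,\<dots>,n}\<close>, on the space \<open>Dspace n\<close>.\<close>
definition uniform_topology :: "nat \<Rightarrow> (nat \<Rightarrow> real \<Rightarrow> real) topology" where
  "uniform_topology n = topology (uniform_open n)"

lemma openin_uniform_topology: "openin (uniform_topology n) = uniform_open n"
  by (simp add: uniform_topology_def istopology_uniform_open topology_inverse')

lemma topspace_uniform_topology: "topspace (uniform_topology n) = Dspace n"
proof
  show "topspace (uniform_topology n) \<subseteq> Dspace n"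
    unfolding topspace_def openin_uniform_topology uniform_open_def by auto
  have "uniform_open n (Dspace n)"
    unfolding uniform_open_def by (auto intro: exI[of _ 1])
  then show "Dspace n \<subseteq> topspace (uniform_topology n)"
    unfolding topspace_def openin_uniform_topology by auto
qed

definition Dspace_down :: "nat \<Rightarrow> (nat \<Rightarrow> real \<Rightarrow> real) set" where
  "Dspace_down n = uniform_topology n closure_of Dspace_down_minus n"

lemma Dspace_down_iff:
  "f \<in> Dspace_down n \<longleftrightarrow> f \<in> Dspace n \<and>
     (\<forall>\<epsilon>>0. \<exists>g\<in>Dspace_down_minus n. \<forall>i\<in>{1..n}. \<forall>x\<ge>0. \<bar>f i x - g i x\<bar> < \<epsilon>)"
  (is "?L \<longleftrightarrow> ?R")
proof
  assume ?L
  then have f: "f \<in> Dspace n"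
    and cl: "\<And>U. uniform_open n U \<Longrightarrow> f \<in> U \<Longrightarrow> \<exists>g\<in>Dspace_down_minus n. g \<in> U"
    unfolding Dspace_down_def in_closure_of topspace_uniform_topology openin_uniform_topology
    by auto
  have "\<exists>g\<in>Dspace_down_minus n. \<forall>i\<in>{1..n}. \<forall>x\<ge>0. \<bar>f i x - g i x\<bar> < \<epsilon>" if "\<epsilon> > 0" for \<epsilon>
  proof -
    define U where
      "U = {g \<in> Dspace n. \<exists>d<\<epsilon>. \<forall>i\<in>{1..n}. \<forall>x\<ge>0. \<bar>f i x - g i x\<bar> \<le> d}"
    have "uniform_open n U"
      unfolding uniform_open_def
    proof (intro conjI ballI)
      show "U \<subseteq> Dspace n" unfolding U_def by auto
      fix g assume "g \<in> U"
      then obtain d where d: "d < \<epsilon>" "\<And>i x. i \<in> {1..n} \<Longrightarrow> x \<ge> 0 \<Longrightarrow> \<bar>f i x - g i x\<bar> \<le> d"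
        unfolding U_def by blast
      have "h \<in> U" if h: "h \<in> Dspace n" "\<forall>i\<in>{1..n}. \<forall>x\<ge>0. \<bar>g i x - h i x\<bar> < (\<epsilon> - d) / 2" for h
      proof -
        have "\<bar>f i x - h i x\<bar> \<le> (\<epsilon> + d) / 2" if "i \<in> {1..n}" "x \<ge> 0" for i x
        proof -
          have "\<bar>g i x - h i x\<bar> < (\<epsilon> - d) / 2" using h(2) that by blast
          then show ?thesis using d(2)[OF that] by argo
        qed
        moreover have "(\<epsilon> + d) / 2 < \<epsilon>" using d(1) by simp
        ultimately show ?thesis using h(1) unfolding U_def by blast
      qed
      then show "\<exists>\<delta>>0. \<forall>h\<in>Dspace n. (\<forall>i\<in>{1..n}. \<forall>x\<ge>0. \<bar>g i x - h i x\<bar> < \<delta>) \<longrightarrow> h \<in> U"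
        using d(1) by (intro exI[of _ "(\<epsilon> - d) / 2"]) auto
    qed
    moreover have "f \<in> U"
      unfolding U_def using f that by (auto intro!: exI[of _ 0])
    ultimately obtain g where g: "g \<in> Dspace_down_minus n" "g \<in> U" using cl by blast
    then obtain d where "d < \<epsilon>" "\<forall>i\<in>{1..n}. \<forall>x\<ge>0. \<bar>f i x - g i x\<bar> \<le> d"
      unfolding U_def by blast
    then have "\<forall>i\<in>{1..n}. \<forall>x\<ge>0. \<bar>f i x - g i x\<bar> < \<epsilon>" by (meson le_less_trans)
    then show ?thesis using g(1) by blast
  qed
  then show ?R using f by blast
next
  assume R: ?R
  have "Dspace_down_minus n \<subseteq> Dspace n" unfolding Dspace_down_minus_def by auto
  then show ?L
    using R unfolding Dspace_down_def in_closure_of topspace_uniform_topology openin_uniform_topology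
      uniform_open_def
    by (meson subsetD)
qed

end

theory Submission
  imports Defs
begin

text \<open>
  The function \<open>f\<close> already lies in \<^const>\<open>Dspace_down_minus\<close>, so its membership in the closure is immediate.

  A \<open>k\<close>-tuple of disjoint paths is described by the times \<open>\<tau> i j\<close> at which path \<open>i\<close> switches from line
  \<open>j + 1\<close> to line \<open>j\<close>.  Sorting the column \<open>\<tau> 1 j, \<dots>, \<tau> k j\<close> for each \<open>j\<close> leaves the union of the paths
  unchanged, because a point \<open>x\<close> of line \<open>j\<close> is covered exactly when more paths have entered line \<open>j\<close> by
  time \<open>x\<close> than have left it strictly before \<open>x\<close> (lemma \<open>disjoint_paths_sorted\<close>).  After sorting, the
  paths are ordered from left to right and disjointness becomes the interlacing condition
  \<open>\<tau> i (j - 1) \<le> \<tau> (i + 1) j\<close>.  Such arrays form a compact set.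

  Up to a constant, the value of an array is the sum of the gains
  \<open>X\<^sub>j(\<tau> i j) = f\<^sub>j\<^sub>+\<^sub>1(\<tau> i j) - f\<^sub>j((\<tau> i j)\<^sup>-)\<close>, minus the jump of \<open>f\<^sub>j\<close> at each time where two consecutive
  paths touch on line \<open>j\<close>, a jump which would otherwise be counted twice (lemma
  \<open>array_value_eq_switch_gains\<close>).  As the \<open>f\<^sub>j\<close> are cadlag and only jump upwards, the value is upper
  semicontinuous, so an optimal array exists for every \<open>t\<close> (lemma \<open>optimal_switch_array\<close>).

  Since \<open>f\<^sub>j\<^sub>+\<^sub>1 - f\<^sub>j \<le> X\<^sub>j\<close> is unbounded above, \<open>X\<^sub>j\<close> has arbitrarily late record times, at which it is at
  least as large as at any earlier time.  Take an array \<open>v\<close> of such record times, none earlier than \<open>T\<close>,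
  which satisfies the interlacing inequalities strictly, and replace an optimal array \<open>\<tau>\<close> by the
  maximum of \<open>\<tau>\<close> and \<open>v\<close> at the entries that disjointness does not force to be \<open>0\<close>.  Every gain can only grow, by the record property, and no two paths
  touch that did not touch before, by strictness; so the new array is optimal too (lemma
  \<open>max_switch_array\<close>).  After the initial switches at time \<open>0\<close>, none of its paths switches before
  \<open>T\<close>, which is the required convergence to the lowest constant paths.
\<close>

section \<open>Mass of a chain of intervals\<close>

lemma components_Union_disjoint_closed:
  fixes \<C> :: "'a::topological_space set set"
  assumes fin: "finite \<C>" and disj: "pairwise disjnt \<C>"
    and closed: "\<And>C. C \<in> \<C> \<Longrightarrow> closed C" and conn: "\<And>C. C \<in> \<C> \<Longrightarrow> connected C"
    and ne: "\<And>C. C \<in> \<C> \<Longrightarrow> C \<noteq> {}"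
  shows "components (\<Union>\<C>) = \<C>"
proof -
  have comp: "C \<in> components (\<Union>\<C>)" if C: "C \<in> \<C>" for C
    unfolding in_components_maximal
  proof (intro conjI allI impI)
    fix D assume D: "D \<noteq> {} \<and> C \<subseteq> D \<and> D \<subseteq> \<Union>\<C> \<and> connected D"
    have cl: "closed (\<Union>(\<C> - {C}))"
      using fin closed by (intro closed_Union) auto
    have "C \<inter> \<Union>(\<C> - {C}) = {}"
      using disj C by (auto simp: pairwise_def disjnt_def)
    then have "C \<inter> D = {} \<or> \<Union>(\<C> - {C}) \<inter> D = {}"
      using connected_closedD[of D C "\<Union>(\<C> - {C})"] cl closed[OF C] D C by blast
    then show "D = C"
      using D ne[OF C] by blast
  qed (use that ne conn in auto)
  have "C \<in> \<C>" if C: "C \<in> components (\<Union>\<C>)" for C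
  proof -
    obtain x where "x \<in> C" "x \<in> \<Union>\<C>"
      using in_components_nonempty[OF C] in_components_subset[OF C] by blast
    then obtain D where D: "D \<in> \<C>" "x \<in> D" by blast
    then show ?thesis
      using components_eq[OF C comp[OF D(1)]] \<open>x \<in> C\<close> by blast
  qed
  with comp show ?thesis by blast
qed

text \<open>
  An interval to the right of a compact set is a new component when there is a gap before it; when it
  starts at the maximum of the set, it only prolongs the last component.
\<close>
lemma components_compact_Un_interval:
  fixes f L :: "real \<Rightarrow> real"
  defines "\<mu> \<equiv> \<lambda>A. \<Sum>C\<in>components A. f (Sup C) - L (Inf C)"
  assumes A: "compact A" "finite (components A)" "b \<in> A" "\<And>x. x \<in> A \<Longrightarrow> x \<le> b"
    and le: "b \<le> c" "c \<le> d"
  shows "finite (components (A \<union> {c..d}))"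
    and "\<mu> (A \<union> {c..d}) = \<mu> A + f d - f b + (if b < c then f b - L c else 0)"
proof -
  have cl: "closed C" "connected C" "C \<noteq> {}" "C \<subseteq> A" if "C \<in> components A" for C
    using closed_components[OF compact_imp_closed[OF A(1)] that] in_components_connected[OF that]
      in_components_nonempty[OF that] in_components_subset[OF that] by blast+
  have disj: "pairwise disjnt (components A)"
    by (simp add: pairwise_disjoint_components disjnt_def pairwise_def components_nonoverlap)
  have UA: "\<Union>(components A) = A" by simp
  have "finite (components (A \<union> {c..d})) \<and>
    \<mu> (A \<union> {c..d}) = \<mu> A + f d - f b + (if b < c then f b - L c else 0)"
  proof (cases "b < c")
    case True
    have new: "{c..d} \<notin> components A"
      using cl(4)[of "{c..d}"] A(4)[of d] True le subsetD[of "{c..d}" A d] by auto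
    have "components (\<Union>(insert {c..d} (components A))) = insert {c..d} (components A)"
    proof (rule components_Union_disjoint_closed)
      have "C \<inter> {c..d} = {}" if "C \<in> components A" for C
        using cl(4)[OF that] A(4) True by force
      then show "pairwise disjnt (insert {c..d} (components A))"
        using disj by (auto simp: pairwise_insert disjnt_def)
    qed (use A(2) cl le in auto)
    then have "components (A \<union> {c..d}) = insert {c..d} (components A)"
      using UA by (simp add: Un_commute)
    then show ?thesis
      using A(2) new True le by (simp add: \<mu>_def)
  next
    case False
    then have c: "c = b" using le by simp
    obtain C0 where C0: "C0 \<in> components A" "b \<in> C0"
      using A(3) UA by blast
    define R where "R = components A - {C0}"
    have R: "C \<subseteq> A" "b \<notin> C" if "C \<in> R" for C
      using that C0 cl(4) components_nonoverlap[of C A C0] unfolding R_def by blast+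
    have dis: "C \<inter> (C0 \<union> {b..d}) = {}" if "C \<in> R" for C
    proof -
      have "C \<inter> C0 = {}"
        using that C0 components_nonoverlap[of C A C0] unfolding R_def by blast
      moreover have "C \<inter> {b..d} = {}"
        using R[OF that] A(4) by force
      ultimately show ?thesis by blast
    qed
    have ne: "C0 \<union> {b..d} \<noteq> {}" using C0 by blast
    have new: "C0 \<union> {b..d} \<notin> R"
      using dis ne by blast
    have conn: "connected (C0 \<union> {b..d})"
      by (rule connected_Un) (use C0 cl(2) le c in auto)
    have "components (\<Union>(insert (C0 \<union> {b..d}) R)) = insert (C0 \<union> {b..d}) R"
    proof (rule components_Union_disjoint_closed)
      show "pairwise disjnt (insert (C0 \<union> {b..d}) R)"
        using disj dis by (auto simp: pairwise_insert disjnt_def R_def pairwise_def)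
    qed (use A(2) cl C0 conn ne in \<open>auto simp: R_def\<close>)
    moreover have "\<Union>(insert (C0 \<union> {b..d}) R) = A \<union> {c..d}"
    proof -
      have "C0 \<union> \<Union>R = \<Union>(insert C0 R)" by simp
      also have "insert C0 R = components A" using C0(1) unfolding R_def by blast
      finally have "C0 \<union> \<Union>R = A" by simp
      then show ?thesis using c by auto
    qed
    ultimately have comps: "components (A \<union> {c..d}) = insert (C0 \<union> {b..d}) R" by simp
    have sup0: "Sup C0 = b"
      using C0 cl(4) A(4) by (intro cSup_eq_maximum) auto
    have sup1: "Sup (C0 \<union> {b..d}) = d"
      using C0 cl(4) A(4) le c by (intro cSup_eq_maximum) force+
    have bdd: "bdd_below C0"
      by (rule bdd_below_mono[OF bounded_imp_bdd_below[OF compact_imp_bounded[OF A(1)]] cl(4)[OF C0(1)]])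
    have "Inf (C0 \<union> {b..d}) = inf (Inf C0) b"
      using C0 bdd le c by (subst cInf_union_distrib) auto
    also have "\<dots> = Inf C0"
      using cInf_lower[OF C0(2) bdd] by (simp add: inf_absorb1)
    finally have inf1: "Inf (C0 \<union> {b..d}) = Inf C0" .
    have "\<mu> A = f b - L (Inf C0) + (\<Sum>C\<in>R. f (Sup C) - L (Inf C))"
      using sum.remove[OF A(2) C0(1), of "\<lambda>C. f (Sup C) - L (Inf C)"] sup0
      unfolding \<mu>_def R_def by simp
    moreover have "\<mu> (A \<union> {c..d}) = f d - L (Inf C0) + (\<Sum>C\<in>R. f (Sup C) - L (Inf C))"
      unfolding \<mu>_def comps using new A(2) sup1 inf1 by (simp add: R_def)
    ultimately show ?thesis
      using comps A(2) c by (simp add: R_def)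
  qed
  then show "finite (components (A \<union> {c..d}))"
    and "\<mu> (A \<union> {c..d}) = \<mu> A + f d - f b + (if b < c then f b - L c else 0)" by auto
qed

text \<open>
  The mass of two intervals \<open>[\<cdot>, b]\<close> and \<open>[a, \<cdot>]\<close> with \<open>b \<le> a\<close>, compared with the mass of their hull: if
  \<open>b = a\<close> they merge and nothing is lost, not even the jump at \<open>a\<close>.
\<close>
definition gap_value :: "(real \<Rightarrow> real) \<Rightarrow> real \<Rightarrow> real \<Rightarrow> real" where
  "gap_value g b a = (if b < a then g b - left_lim g a else 0)"

definition chain_value :: "(real \<Rightarrow> real) \<Rightarrow> nat \<Rightarrow> (nat \<Rightarrow> real) \<Rightarrow> (nat \<Rightarrow> real) \<Rightarrow> real" where
  "chain_value g k a b = g (b k) - left_lim g (a 1) + (\<Sum>i\<in>{1..<k}. gap_value g (b i) (a (Suc i)))"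

text \<open>
  This makes the sum over components in \<^const>\<open>df\<close> explicit in terms of the endpoints of a chain of
  intervals, consecutive ones of which may touch.
\<close>
lemma sum_components_chain:
  assumes "1 \<le> k" and "\<And>i. i \<in> {1..k} \<Longrightarrow> a i \<le> b i"
    and "\<And>i. i \<in> {1..<k} \<Longrightarrow> b i \<le> a (Suc i)"
  shows "(\<Sum>C\<in>components (\<Union>i\<in>{1..k}. {a i..b i}). g (Sup C) - left_lim g (Inf C))
    = chain_value g k a b"
proof -
  let ?U = "\<lambda>k. \<Union>i\<in>{1..k}. {a i..b i}"
  have "finite (components (?U k)) \<and> b k \<in> ?U k \<and> (\<forall>x\<in>?U k. x \<le> b k) \<and>
    (\<Sum>C\<in>components (?U k). g (Sup C) - left_lim g (Inf C)) = chain_value g k a b"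
    using assms
  proof (induction k rule: nat_induct_at_least)
    case base
    have "components {a 1..b 1} = {{a 1..b 1}}"
      using base by (subst components_eq_sing_iff) auto
    then show ?case using base by (simp add: chain_value_def)
  next
    case (Suc k)
    have "finite (components (?U k)) \<and> b k \<in> ?U k \<and> (\<forall>x\<in>?U k. x \<le> b k) \<and>
      (\<Sum>C\<in>components (?U k). g (Sup C) - left_lim g (Inf C)) = chain_value g k a b"
      by (rule Suc.IH) (use Suc.prems in auto)
    then have IH: "finite (components (?U k))" "b k \<in> ?U k" "\<And>x. x \<in> ?U k \<Longrightarrow> x \<le> b k"
      "(\<Sum>C\<in>components (?U k). g (Sup C) - left_lim g (Inf C)) = chain_value g k a b"
      by blast+
    have le: "b k \<le> a (Suc k)" "a (Suc k) \<le> b (Suc k)" using Suc by auto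
    have U: "?U (Suc k) = ?U k \<union> {a (Suc k)..b (Suc k)}"
      using Suc.hyps by (auto simp: atLeastAtMostSuc_conv)
    have cpt: "compact (?U k)" by (intro compact_UN) auto
    note step = components_compact_Un_interval(1)[OF cpt IH(1) IH(2) IH(3) le]
      components_compact_Un_interval(2)[OF cpt IH(1) IH(2) IH(3) le, where f = g and L = "left_lim g"]
    have "chain_value g (Suc k) a b
      = chain_value g k a b + g (b (Suc k)) - g (b k) + gap_value g (b k) (a (Suc k))"
      using Suc.hyps unfolding chain_value_def by (simp add: sum.atLeastLessThan_Suc)
    then have val: "(\<Sum>C\<in>components (?U (Suc k)). g (Sup C) - left_lim g (Inf C)) = chain_value g (Suc k) a b"
      using step(2) IH(4) unfolding U gap_value_def by linarith
    have max: "\<forall>x\<in>?U (Suc k). x \<le> b (Suc k)"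
    proof
      fix x assume "x \<in> ?U (Suc k)"
      then show "x \<le> b (Suc k)"
        using IH(3)[of x] le unfolding U Un_iff atLeastAtMost_iff by linarith
    qed
    have mem: "b (Suc k) \<in> ?U (Suc k)"
      using le unfolding U Un_iff atLeastAtMost_iff by simp
    show ?case
      using step(1) mem max val unfolding U by blast
  qed
  then show ?thesis by blast
qed

section \<open>Arrays of switching times\<close>

definition stair :: "nat \<Rightarrow> (nat \<Rightarrow> real) \<Rightarrow> (real \<times> nat) set" where
  "stair n s = (\<Union>j\<in>{1..n}. {s j..s (j - 1)} \<times> {j})"

lemma mem_stair: "(x, j) \<in> stair n s \<longleftrightarrow> j \<in> {1..n} \<and> s j \<le> x \<and> x \<le> s (j - 1)"
  unfolding stair_def by auto

text \<open>
  The entry \<open>\<tau> i j\<close> is the time at which path \<open>i\<close> switches from line \<open>j + 1\<close> to line \<open>j\<close>, and the last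
  condition says that path \<open>i\<close> has left line \<open>j\<close> when path \<open>i + 1\<close> enters it.  All entries, also those
  outside the relevant index range, are bounded, so that the arrays form a compact set in the
  product topology.
\<close>
definition switch_array :: "nat \<Rightarrow> nat \<Rightarrow> real \<Rightarrow> (nat \<Rightarrow> nat \<Rightarrow> real) \<Rightarrow> bool" where
  "switch_array n k t \<tau> \<longleftrightarrow> (\<forall>i j. 0 \<le> \<tau> i j \<and> \<tau> i j \<le> t) \<and>
     (\<forall>i\<in>{1..k}. \<tau> i n = 0 \<and> \<tau> i 0 = t \<and> (\<forall>j\<in>{1..n}. \<tau> i j \<le> \<tau> i (j - 1))) \<and>
     (\<forall>i\<in>{1..<k}. \<forall>j\<in>{1..n}. \<tau> i (j - 1) \<le> \<tau> (Suc i) j)"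

lemma switch_arrayD:
  assumes "switch_array n k t \<tau>"
  shows "0 \<le> \<tau> i j" "\<tau> i j \<le> t"
    and "i \<in> {1..k} \<Longrightarrow> \<tau> i n = 0" "i \<in> {1..k} \<Longrightarrow> \<tau> i 0 = t"
    and "i \<in> {1..k} \<Longrightarrow> j \<in> {1..n} \<Longrightarrow> \<tau> i j \<le> \<tau> i (j - 1)"
    and "i \<in> {1..<k} \<Longrightarrow> j \<in> {1..n} \<Longrightarrow> \<tau> i (j - 1) \<le> \<tau> (Suc i) j"
  using assms unfolding switch_array_def by blast+

lemma switch_array_antimono:
  assumes S: "switch_array n k t \<tau>" and i: "i \<in> {1..k}" and "j \<le> m" "m \<le> n"
  shows "\<tau> i m \<le> \<tau> i j"
  using assms(3,4)
proof (induction rule: dec_induct)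
  case (step m)
  then show ?case using switch_arrayD(5)[OF S i, of "Suc m"] by simp
qed simp

lemma switch_array_mono:
  assumes S: "switch_array n k t \<tau>" and "1 \<le> i" "i \<le> i'" "i' \<le> k" "j \<le> n"
  shows "\<tau> i j \<le> \<tau> i' j"
  using assms(3,4)
proof (induction rule: dec_induct)
  case (step m)
  then have m: "m \<in> {1..<k}" "m \<in> {1..k}" "Suc m \<in> {1..k}" using assms(2) by auto
  have "\<tau> m j \<le> \<tau> (Suc m) j"
  proof (cases "j = 0")
    case True
    then show ?thesis using switch_arrayD(4)[OF S] m by simp
  next
    case False
    then have "j \<in> {1..n}" using assms(5) by auto
    then show ?thesis
      using switch_arrayD(5)[OF S m(2)] switch_arrayD(6)[OF S m(1)] by fastforce
  qed
  then show ?case using step by simp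
qed simp

lemma switch_array_interlace:
  assumes S: "switch_array n k t \<tau>" and "1 \<le> i" "i < i'" "i' \<le> k" "j \<in> {1..n}"
  shows "\<tau> i (j - 1) \<le> \<tau> i' j"
proof -
  have "\<tau> i (j - 1) \<le> \<tau> (Suc i) j"
    using switch_arrayD(6)[OF S, of i j] assms by auto
  also have "\<dots> \<le> \<tau> i' j"
    using switch_array_mono[OF S, of "Suc i" i' j] assms by auto
  finally show ?thesis .
qed

text \<open>
  By interlacing, \<open>\<tau> i (n - k + i) \<le> \<tau> (i + 1) (n - k + i + 1) \<le> \<dots> \<le> \<tau> k n = 0\<close>: the \<open>i\<close>-th of \<open>k\<close> disjoint
  paths has to reach line \<open>n - k + i\<close> already at time \<open>0\<close>.
\<close>
lemma switch_array_eq_0: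
  assumes S: "switch_array n k t \<tau>" and "i \<in> {1..k}" "n - k + i \<le> j" "j \<le> n" "k \<le> n"
  shows "\<tau> i j = 0"
  using assms(2-4)
proof (induction "k - i" arbitrary: i j)
  case 0
  then have "i = k" "j = n" using assms(5) by auto
  then show ?case using switch_arrayD(3)[OF S 0(2)] by simp
next
  case (Suc d)
  show ?case
  proof (cases "j = n")
    case True
    then show ?thesis using switch_arrayD(3)[OF S] Suc by auto
  next
    case False
    have "\<tau> (Suc i) (Suc j) = 0"
      using Suc False by (intro Suc(1)) auto
    moreover have "\<tau> i j \<le> \<tau> (Suc i) (Suc j)"
      using switch_arrayD(6)[OF S, of i "Suc j"] Suc False by auto
    ultimately show ?thesis using switch_arrayD(1)[OF S, of i j] by simp
  qed
qed

lemma stair_is_path: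
  assumes S: "switch_array n k t \<tau>" and i: "i \<in> {1..k}"
  shows "is_path n 0 t (stair n (\<tau> i))"
  unfolding is_path_def stair_def
  using switch_arrayD[OF S] i order_trans[OF switch_arrayD(1,2)[OF S, of i 0]] by blast

lemma stairs_disjoint_paths:
  assumes S: "switch_array n k t \<tau>"
  shows "disjoint_paths n k t (\<lambda>i. stair n (\<tau> i))"
proof -
  have fin: "finite (stair n (\<tau> i) \<inter> stair n (\<tau> i'))" if "1 \<le> i" "i < i'" "i' \<le> k" for i i'
  proof (rule finite_subset)
    show "stair n (\<tau> i) \<inter> stair n (\<tau> i') \<subseteq> (\<lambda>j. (\<tau> i' j, j)) ` {1..n}"
    proof
      fix z assume z: "z \<in> stair n (\<tau> i) \<inter> stair n (\<tau> i')"
      obtain x j where zx: "z = (x, j)" by force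
      then have "j \<in> {1..n}" "x \<le> \<tau> i (j - 1)" "\<tau> i' j \<le> x"
        using z by (auto simp: mem_stair)
      then have "x = \<tau> i' j" using switch_array_interlace[OF S that] by fastforce
      then show "z \<in> (\<lambda>j. (\<tau> i' j, j)) ` {1..n}" using zx \<open>j \<in> {1..n}\<close> by blast
    qed
  qed simp
  have "finite (stair n (\<tau> i) \<inter> stair n (\<tau> i'))"
    if "i \<in> {1..k}" "i' \<in> {1..k}" "i \<noteq> i'" for i i'
    using fin[of i i'] fin[of i' i] that by (cases i i' rule: linorder_cases) (auto simp: Int_commute)
  then show ?thesis
    using stair_is_path[OF S] unfolding disjoint_paths_def essentially_disjoint_def by blast
qed

text \<open>
  The point where path \<open>i\<close> leaves line \<open>l\<close> does not come after the point where path \<open>i'\<close> reaches a line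
  \<open>m < l\<close>, because switching times decrease in the line and increase in the path.
\<close>
lemma stairs_left_of:
  assumes S: "switch_array n k t \<tau>" and ii: "1 \<le> i" "i < i'" "i' \<le> k"
  shows "left_of (stair n (\<tau> i)) (stair n (\<tau> i'))"
proof -
  have "x \<le> y" if "(x, l) \<in> stair n (\<tau> i)" "(y, m) \<in> stair n (\<tau> i')" "m < l" for x l y m
  proof -
    have "x \<le> \<tau> i (l - 1)" using that by (simp add: mem_stair)
    also have "\<dots> \<le> \<tau> i m"
      using that ii by (intro switch_array_antimono[OF S]) (auto simp: mem_stair)
    also have "\<dots> \<le> \<tau> i' m"
      using that ii by (intro switch_array_mono[OF S]) (auto simp: mem_stair)
    also have "\<dots> \<le> y" using that by (simp add: mem_stair)
    finally show ?thesis .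
  qed
  then show ?thesis unfolding left_of_def by (auto simp: not_less[symmetric])
qed

section \<open>Sorting disjoint paths\<close>

lemma sorted_nth_iff_length_filter:
  assumes "sorted xs" "m < length xs"
    and P: "\<And>x y. P y \<Longrightarrow> x \<le> y \<Longrightarrow> P x"
  shows "P (xs ! m) \<longleftrightarrow> m < length (filter P xs)"
  using assms(1,2)
proof (induction xs arbitrary: m)
  case (Cons x xs)
  show ?case
  proof (cases m)
    case 0
    have "filter P xs = []" if "\<not> P x"
      using that Cons.prems(1) P by (auto simp: filter_empty_conv)
    then show ?thesis using 0 by auto
  next
    case (Suc m')
    have "\<not> P (xs ! m')" if "\<not> P x"
      using that Cons.prems P nth_mem[of m' xs] Suc by auto
    moreover have "filter P xs = []" if "\<not> P x"
      using that Cons.prems(1) P by (auto simp: filter_empty_conv)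
    ultimately show ?thesis
      using Cons Suc by auto
  qed
qed simp

definition order_stat :: "nat \<Rightarrow> (nat \<Rightarrow> real) \<Rightarrow> nat \<Rightarrow> real" where
  "order_stat k a i = sort (map a [1..<Suc k]) ! (i - 1)"

text \<open>
  The \<open>i\<close>-th smallest of \<open>k\<close> numbers lies in a down-closed set iff at least \<open>i\<close> of them do.  Every fact
  about sorted columns is derived from this equivalence.
\<close>
lemma order_stat_iff_card:
  assumes i: "i \<in> {1..k}" and P: "\<And>x y. P y \<Longrightarrow> x \<le> y \<Longrightarrow> P x"
  shows "P (order_stat k a i) \<longleftrightarrow> i \<le> card {l\<in>{1..k}. P (a l)}"
proof -
  have "length (filter P (sort (map a [1..<Suc k]))) = length (filter P (map a [1..<Suc k]))"
    by (metis mset_filter mset_sort size_mset)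
  also have "\<dots> = card (set (filter (P \<circ> a) [1..<Suc k]))"
    by (simp only: filter_map length_map distinct_card distinct_filter distinct_upt)
  also have "set (filter (P \<circ> a) [1..<Suc k]) = {l\<in>{1..k}. P (a l)}" by auto
  finally have len: "length (filter P (sort (map a [1..<Suc k]))) = card {l\<in>{1..k}. P (a l)}" .
  have "P (order_stat k a i) \<longleftrightarrow> i - 1 < card {l\<in>{1..k}. P (a l)}"
    unfolding order_stat_def len[symmetric]
    by (rule sorted_nth_iff_length_filter) (use i P in auto)
  then show ?thesis using i by auto
qed

lemma order_stat_in_range:
  assumes "i \<in> {1..k}"
  shows "order_stat k a i \<in> a ` {1..k}"
proof -
  have "order_stat k a i \<in> set (sort (map a [1..<Suc k]))"
    unfolding order_stat_def using assms by (intro nth_mem) auto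
  then show ?thesis by (auto simp del: upt_Suc)
qed

text \<open>
  The multiplicity with which intervals cover a point \<open>x\<close> is a difference of two counts, one of left and
  one of right endpoints.  Sorting the endpoints separately does not change it.
\<close>
lemma card_covering:
  fixes a b :: "nat \<Rightarrow> real"
  assumes "\<And>l. l \<in> {1..k} \<Longrightarrow> a l \<le> b l"
  shows "card {l\<in>{1..k}. a l \<le> x \<and> x \<le> b l} + card {l\<in>{1..k}. b l < x} = card {l\<in>{1..k}. a l \<le> x}"
proof -
  have "{l\<in>{1..k}. a l \<le> x} = {l\<in>{1..k}. a l \<le> x \<and> x \<le> b l} \<union> {l\<in>{1..k}. b l < x}"
    using assms by (auto intro: order_trans less_imp_le simp: not_less)
  then show ?thesis by (subst card_Un_disjoint[symmetric]) auto
qed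

lemma Union_order_stat_intervals:
  fixes a b :: "nat \<Rightarrow> real"
  assumes ab: "\<And>l. l \<in> {1..k} \<Longrightarrow> a l \<le> b l"
  shows "(\<Union>i\<in>{1..k}. {order_stat k a i..order_stat k b i}) = (\<Union>l\<in>{1..k}. {a l..b l})"
proof (rule set_eqI)
  fix x
  let ?A = "card {l\<in>{1..k}. a l \<le> x}" and ?B = "card {l\<in>{1..k}. b l < x}"
  have "?A \<le> card {1..k}" by (intro card_mono) auto
  then have "?A \<le> k" by simp
  have stat: "order_stat k a i \<le> x \<longleftrightarrow> i \<le> ?A" "order_stat k b i < x \<longleftrightarrow> i \<le> ?B" if "i \<in> {1..k}" for i
    using order_stat_iff_card[OF that, of "\<lambda>y. y \<le> x" a] order_stat_iff_card[OF that, of "\<lambda>y. y < x" b]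
    by auto
  have "x \<in> (\<Union>i\<in>{1..k}. {order_stat k a i..order_stat k b i}) \<longleftrightarrow> (\<exists>i\<in>{1..k}. i \<le> ?A \<and> \<not> i \<le> ?B)"
    using stat by (auto simp: not_less[symmetric])
  also have "\<dots> \<longleftrightarrow> ?B < ?A"
  proof
    assume "?B < ?A"
    then have "?A \<in> {1..k}" "\<not> ?A \<le> ?B" using \<open>?A \<le> k\<close> by auto
    then show "\<exists>i\<in>{1..k}. i \<le> ?A \<and> \<not> i \<le> ?B" by blast
  qed auto
  also have "\<dots> \<longleftrightarrow> {l\<in>{1..k}. a l \<le> x \<and> x \<le> b l} \<noteq> {}"
  proof -
    have "finite {l\<in>{1..k}. a l \<le> x \<and> x \<le> b l}" by simp
    then show ?thesis
      using card_covering[of k a b x, OF ab] card_gt_0_iff[of "{l\<in>{1..k}. a l \<le> x \<and> x \<le> b l}"]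
      by linarith
  qed
  also have "\<dots> \<longleftrightarrow> x \<in> (\<Union>l\<in>{1..k}. {a l..b l})" by auto
  finally show "x \<in> (\<Union>i\<in>{1..k}. {order_stat k a i..order_stat k b i}) \<longleftrightarrow> x \<in> (\<Union>l\<in>{1..k}. {a l..b l})" .
qed

lemma order_stat_mono:
  fixes a b :: "nat \<Rightarrow> real"
  assumes ab: "\<And>l. l \<in> {1..k} \<Longrightarrow> a l \<le> b l" and i: "i \<in> {1..k}"
  shows "order_stat k a i \<le> order_stat k b i"
proof -
  let ?x = "order_stat k b i"
  have "i \<le> card {l\<in>{1..k}. b l \<le> ?x}"
    using order_stat_iff_card[OF i, of "\<lambda>y. y \<le> ?x" b] by auto
  also have "\<dots> \<le> card {l\<in>{1..k}. a l \<le> ?x}"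
    using ab by (intro card_mono) (auto intro: order_trans)
  finally show ?thesis
    using order_stat_iff_card[OF i, of "\<lambda>y. y \<le> ?x" a] by auto
qed

text \<open>
  If the inequality failed, every point strictly between the two values would be covered at least
  twice, so two of the intervals would have infinite intersection.
\<close>
lemma order_stat_interlace:
  fixes a b :: "nat \<Rightarrow> real"
  assumes ab: "\<And>l. l \<in> {1..k} \<Longrightarrow> a l \<le> b l" and i: "i \<in> {1..<k}"
    and fin: "\<And>l m. l \<in> {1..k} \<Longrightarrow> m \<in> {1..k} \<Longrightarrow> l \<noteq> m \<Longrightarrow> finite ({a l..b l} \<inter> {a m..b m})"
  shows "order_stat k b i \<le> order_stat k a (Suc i)"
proof (rule ccontr)
  assume "\<not> ?thesis"
  then have less: "order_stat k a (Suc i) < order_stat k b i" by simp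
  have ik: "i \<in> {1..k}" "Suc i \<in> {1..k}" using i by auto
  let ?D = "\<Union>(l, m)\<in>{(l, m). l \<in> {1..k} \<and> m \<in> {1..k} \<and> l \<noteq> m}. {a l..b l} \<inter> {a m..b m}"
  have "finite {(l, m). l \<in> {1..k} \<and> m \<in> {1..k} \<and> l \<noteq> m}"
    by (rule finite_subset[of _ "{1..k} \<times> {1..k}"]) auto
  then have "finite ?D" using fin by auto
  moreover have "{order_stat k a (Suc i)<..<order_stat k b i} \<subseteq> ?D"
  proof
    fix x assume x: "x \<in> {order_stat k a (Suc i)<..<order_stat k b i}"
    let ?C = "{l\<in>{1..k}. a l \<le> x \<and> x \<le> b l}"
    have "Suc i \<le> card {l\<in>{1..k}. a l \<le> x}"
      using order_stat_iff_card[OF ik(2), of "\<lambda>y. y \<le> x" a] x by auto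
    moreover have "\<not> i \<le> card {l\<in>{1..k}. b l < x}"
      using order_stat_iff_card[OF ik(1), of "\<lambda>y. y < x" b] x by auto
    ultimately have "2 \<le> card ?C"
      using card_covering[of k a b x] ab by auto
    then have "\<not> card ?C \<le> Suc 0" by simp
    moreover have "finite ?C" by simp
    ultimately obtain l m where "l \<in> ?C" "m \<in> ?C" "l \<noteq> m"
      unfolding card_le_Suc0_iff_eq[OF \<open>finite ?C\<close>] by blast
    then show "x \<in> ?D" by auto
  qed
  ultimately show False
    using less infinite_Ioo finite_subset by blast
qed

text \<open>
  Disjoint paths may cross, since one can jump over another at a single time.  Sorting the switching
  times line by line removes the crossings and keeps the union, and hence the mass.
\<close>
lemma disjoint_paths_sorted:
  assumes p: "disjoint_paths n k t p" and k: "1 \<le> k"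
  obtains \<tau> where "switch_array n k t \<tau>" "(\<Union>i\<in>{1..k}. stair n (\<tau> i)) = (\<Union>i\<in>{1..k}. p i)"
proof -
  have "\<forall>i\<in>{1..k}. \<exists>s. s n = 0 \<and> s 0 = t \<and> (\<forall>j\<in>{1..n}. s j \<le> s (j - 1)) \<and> p i = stair n s"
    using p unfolding disjoint_paths_def is_path_def stair_def by blast
  then obtain s where s: "\<And>i. i \<in> {1..k} \<Longrightarrow> s i n = 0" "\<And>i. i \<in> {1..k} \<Longrightarrow> s i 0 = t"
    "\<And>i j. i \<in> {1..k} \<Longrightarrow> j \<in> {1..n} \<Longrightarrow> s i j \<le> s i (j - 1)"
    "\<And>i. i \<in> {1..k} \<Longrightarrow> p i = stair n (s i)"
    unfolding bchoice_iff by blast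
  have "1 \<in> {1..k}" using k by simp
  then have t: "0 \<le> t" using p unfolding disjoint_paths_def is_path_def by blast
  have anti: "s i m \<le> s i j" if "i \<in> {1..k}" "j \<le> m" "m \<le> n" for i j m
    using that(2,3)
  proof (induction rule: dec_induct)
    case (step m)
    then show ?case using s(3)[OF that(1), of "Suc m"] by simp
  qed simp
  have range: "0 \<le> s i j" "s i j \<le> t" if "i \<in> {1..k}" "j \<le> n" for i j
    using anti[OF that(1), of 0 j] anti[OF that(1), of j n] s(1,2)[OF that(1)] that by auto
  \<comment> \<open>The default \<open>0\<close> keeps the irrelevant entries in \<open>[0, t]\<close>.\<close>
  define \<tau> where "\<tau> i j = (if i \<in> {1..k} \<and> j \<le> n then order_stat k (\<lambda>l. s l j) i else 0)" for i j
  have fin: "finite ({s l j..s l (j - 1)} \<inter> {s m j..s m (j - 1)})"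
    if "l \<in> {1..k}" "m \<in> {1..k}" "l \<noteq> m" "j \<in> {1..n}" for l m j
  proof -
    have "finite (stair n (s l) \<inter> stair n (s m))"
      using p s(4) that unfolding disjoint_paths_def essentially_disjoint_def by metis
    moreover have "(\<lambda>x. (x, j)) ` ({s l j..s l (j - 1)} \<inter> {s m j..s m (j - 1)})
      \<subseteq> stair n (s l) \<inter> stair n (s m)"
      using that by (auto simp: mem_stair)
    ultimately have "finite ((\<lambda>x. (x, j)) ` ({s l j..s l (j - 1)} \<inter> {s m j..s m (j - 1)}))"
      by (rule finite_subset[rotated])
    then show ?thesis by (rule finite_imageD) (auto simp: inj_on_def)
  qed
  have "switch_array n k t \<tau>"
    unfolding switch_array_def
  proof (intro conjI allI ballI)
    show "0 \<le> \<tau> i j" "\<tau> i j \<le> t" for i j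
      using order_stat_in_range[of i k "\<lambda>l. s l j"] range t unfolding \<tau>_def by auto
    show "\<tau> i n = 0" if "i \<in> {1..k}" for i
      using order_stat_in_range[OF that, of "\<lambda>l. s l n"] s(1) that unfolding \<tau>_def by auto
    show "\<tau> i 0 = t" if "i \<in> {1..k}" for i
      using order_stat_in_range[OF that, of "\<lambda>l. s l 0"] s(2) that unfolding \<tau>_def by auto
    show "\<tau> i j \<le> \<tau> i (j - 1)" if "i \<in> {1..k}" "j \<in> {1..n}" for i j
      using order_stat_mono[of k "\<lambda>l. s l j" "\<lambda>l. s l (j - 1)" i] s(3) that unfolding \<tau>_def by auto
    show "\<tau> i (j - 1) \<le> \<tau> (Suc i) j" if "i \<in> {1..<k}" "j \<in> {1..n}" for i j
      using order_stat_interlace[of k "\<lambda>l. s l j" "\<lambda>l. s l (j - 1)" i] s(3) fin that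
      unfolding \<tau>_def by auto
  qed
  moreover have "(\<Union>i\<in>{1..k}. stair n (\<tau> i)) = (\<Union>i\<in>{1..k}. p i)"
  proof -
    have "(x, j) \<in> (\<Union>i\<in>{1..k}. stair n (\<tau> i)) \<longleftrightarrow> (x, j) \<in> (\<Union>i\<in>{1..k}. p i)" for x j
    proof (cases "j \<in> {1..n}")
      case True
      have "(x, j) \<in> (\<Union>i\<in>{1..k}. stair n (\<tau> i)) \<longleftrightarrow>
        x \<in> (\<Union>i\<in>{1..k}. {order_stat k (\<lambda>l. s l j) i..order_stat k (\<lambda>l. s l (j - 1)) i})"
        using True by (auto simp: mem_stair \<tau>_def)
      also have "\<dots> \<longleftrightarrow> x \<in> (\<Union>i\<in>{1..k}. {s i j..s i (j - 1)})"
        using Union_order_stat_intervals[of k "\<lambda>l. s l j" "\<lambda>l. s l (j - 1)"] s(3)[OF _ True] by simp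
      also have "\<dots> \<longleftrightarrow> (x, j) \<in> (\<Union>i\<in>{1..k}. p i)"
        using s(4) True by (auto simp: mem_stair)
      finally show ?thesis .
    next
      case False
      then show ?thesis using s(4) by (auto simp: mem_stair)
    qed
    then show ?thesis by (intro set_eqI) (metis surj_pair)
  qed
  ultimately show thesis by (rule that)
qed

section \<open>Value of an array of switching times\<close>

definition array_value :: "nat \<Rightarrow> (nat \<Rightarrow> real \<Rightarrow> real) \<Rightarrow> nat \<Rightarrow> (nat \<Rightarrow> nat \<Rightarrow> real) \<Rightarrow> real" where
  "array_value n f k \<tau> = (\<Sum>j\<in>{1..n}. chain_value (f j) k (\<lambda>i. \<tau> i j) (\<lambda>i. \<tau> i (j - 1)))"

lemma df_stairs:
  assumes S: "switch_array n k t \<tau>" and k: "1 \<le> k"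
  shows "df n f (\<Union>i\<in>{1..k}. stair n (\<tau> i)) = array_value n f k \<tau>"
  unfolding df_def array_value_def
proof (rule sum.cong)
  fix j assume j: "j \<in> {1..n}"
  have sect: "{x. (x, j) \<in> (\<Union>i\<in>{1..k}. stair n (\<tau> i))} = (\<Union>i\<in>{1..k}. {\<tau> i j..\<tau> i (j - 1)})"
    using j by (auto simp: mem_stair)
  show "(\<Sum>C\<in>components {x. (x, j) \<in> (\<Union>i\<in>{1..k}. stair n (\<tau> i))}. f j (Sup C) - left_lim (f j) (Inf C))
    = chain_value (f j) k (\<lambda>i. \<tau> i j) (\<lambda>i. \<tau> i (j - 1))"
    unfolding sect
    by (rule sum_components_chain) (use k j switch_arrayD(5,6)[OF S] in auto)
qed simp

text \<open>
  The subtracted jumps correct the sum of the masses of the intervals for the points shared by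
  consecutive intervals.
\<close>
lemma chain_value_eq:
  assumes "1 \<le> k" and "\<And>i. i \<in> {1..<k} \<Longrightarrow> b i \<le> a (Suc i)"
  shows "chain_value g k a b = (\<Sum>i\<in>{1..k}. g (b i) - left_lim g (a i))
    - (\<Sum>i\<in>{1..<k}. if b i = a (Suc i) then g (b i) - left_lim g (b i) else 0)"
  using assms
proof (induction k rule: nat_induct_at_least)
  case base
  then show ?case by (simp add: chain_value_def)
next
  case (Suc k)
  have "b k \<le> a (Suc k)" using Suc by simp
  then have "chain_value g (Suc k) a b = chain_value g k a b + (g (b (Suc k)) - left_lim g (a (Suc k)))
    - (if b k = a (Suc k) then g (b k) - left_lim g (b k) else 0)"
    using Suc.hyps by (auto simp: chain_value_def gap_value_def)
  then show ?case using Suc by simp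
qed

text \<open>
  The contribution to \<^const>\<open>df\<close> of switching from line \<open>j + 1\<close> to line \<open>j\<close> at time \<open>s\<close>.
\<close>
definition switch_gain :: "(nat \<Rightarrow> real \<Rightarrow> real) \<Rightarrow> nat \<Rightarrow> real \<Rightarrow> real" where
  "switch_gain f j s = f (Suc j) s - left_lim (f j) s"

lemma sum_stair_eq_switch_gains:
  assumes "1 \<le> n"
  shows "(\<Sum>j\<in>{1..n}. f j (s (j - 1)) - left_lim (f j) (s j))
    = f 1 (s 0) - left_lim (f n) (s n) + (\<Sum>j\<in>{1..<n}. switch_gain f j (s j))"
  using assms
  by (induction n rule: nat_induct_at_least) (simp_all add: switch_gain_def)

text \<open>
  Summation by parts along each path turns the masses of its intervals into gains at its switching
  times, so that the value depends on each entry of the array separately, except for the jumps at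
  touching times.
\<close>
lemma array_value_eq_switch_gains:
  assumes S: "switch_array n k t \<tau>" and k: "1 \<le> k" and n: "1 \<le> n"
  shows "array_value n f k \<tau> = real k * f 1 t + (\<Sum>i\<in>{1..k}. \<Sum>j\<in>{1..<n}. switch_gain f j (\<tau> i j))
    - (\<Sum>j\<in>{1..n}. \<Sum>i\<in>{1..<k}. if \<tau> i (j - 1) = \<tau> (Suc i) j
        then f j (\<tau> i (j - 1)) - left_lim (f j) (\<tau> i (j - 1)) else 0)"
proof -
  have "chain_value (f j) k (\<lambda>i. \<tau> i j) (\<lambda>i. \<tau> i (j - 1))
    = (\<Sum>i\<in>{1..k}. f j (\<tau> i (j - 1)) - left_lim (f j) (\<tau> i j))
      - (\<Sum>i\<in>{1..<k}. if \<tau> i (j - 1) = \<tau> (Suc i) j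
        then f j (\<tau> i (j - 1)) - left_lim (f j) (\<tau> i (j - 1)) else 0)" if "j \<in> {1..n}" for j
    using chain_value_eq[of k "\<lambda>i. \<tau> i (j - 1)" "\<lambda>i. \<tau> i j" "f j"] k switch_arrayD(6)[OF S] that by simp
  moreover have "(\<Sum>j\<in>{1..n}. \<Sum>i\<in>{1..k}. f j (\<tau> i (j - 1)) - left_lim (f j) (\<tau> i j))
    = (\<Sum>i\<in>{1..k}. f 1 t + (\<Sum>j\<in>{1..<n}. switch_gain f j (\<tau> i j)))"
  proof (subst sum.swap, rule sum.cong)
    fix i assume i: "i \<in> {1..k}"
    have "left_lim (f n) 0 = 0" by (simp add: left_lim_def)
    then show "(\<Sum>j\<in>{1..n}. f j (\<tau> i (j - 1)) - left_lim (f j) (\<tau> i j))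
      = f 1 t + (\<Sum>j\<in>{1..<n}. switch_gain f j (\<tau> i j))"
      using sum_stair_eq_switch_gains[OF n, of f "\<tau> i"] switch_arrayD(3,4)[OF S i] by simp
  qed simp
  ultimately show ?thesis
    unfolding array_value_def by (simp add: sum_subtractf sum.distrib)
qed

section \<open>Upper semicontinuity and existence of optimizers\<close>

definition usc_on :: "'a::topological_space set \<Rightarrow> ('a \<Rightarrow> real) \<Rightarrow> bool" where
  "usc_on K V \<longleftrightarrow> (\<forall>x\<in>K. \<forall>e>0. \<exists>U. open U \<and> x \<in> U \<and> (\<forall>y\<in>U \<inter> K. V y < V x + e))"

lemma usc_onD:
  assumes "usc_on K V" "x \<in> K" "V x < c"
  shows "\<exists>U. open U \<and> x \<in> U \<and> (\<forall>y\<in>U \<inter> K. V y < c)"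
proof -
  have "c - V x > 0" using assms(3) by simp
  with assms(1,2) have "\<exists>U. open U \<and> x \<in> U \<and> (\<forall>y\<in>U \<inter> K. V y < V x + (c - V x))"
    unfolding usc_on_def by blast
  then show ?thesis by simp
qed

lemma usc_on_attains_max:
  assumes "compact K" "K \<noteq> {}" and usc: "usc_on K V"
  obtains x where "x \<in> K" "\<And>y. y \<in> K \<Longrightarrow> V y \<le> V x"
proof -
  have "\<exists>x\<in>K. \<forall>y\<in>K. V y \<le> V x"
  proof (rule ccontr)
    assume "\<not> ?thesis"
    then have "\<forall>x\<in>K. \<exists>y\<in>K. V x < V y" by (meson not_le)
    then obtain b where b: "\<And>x. x \<in> K \<Longrightarrow> b x \<in> K" "\<And>x. x \<in> K \<Longrightarrow> V x < V (b x)"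
      unfolding Bex_def bchoice_iff by blast
    have "\<forall>x\<in>K. \<exists>U. open U \<and> x \<in> U \<and> (\<forall>y\<in>U \<inter> K. V y < V (b x))"
      using usc_onD[OF usc] b(2) by blast
    then obtain U where U: "\<And>x. x \<in> K \<Longrightarrow> open (U x)" "\<And>x. x \<in> K \<Longrightarrow> x \<in> U x"
      "\<And>x y. x \<in> K \<Longrightarrow> y \<in> U x \<Longrightarrow> y \<in> K \<Longrightarrow> V y < V (b x)"
      unfolding bchoice_iff by blast
    obtain D where D: "D \<subseteq> K" "finite D" "K \<subseteq> (\<Union>x\<in>D. U x)"
      using compactE_image[OF assms(1), of K U] U by blast
    then have ne: "D \<noteq> {}" using assms(2) by auto
    then have "Max ((V \<circ> b) ` D) \<in> (V \<circ> b) ` D" using D(2) by (intro Max_in) auto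
    then obtain d where d: "d \<in> D" "V (b d) = Max ((V \<circ> b) ` D)" by auto
    obtain x where x: "x \<in> D" "b d \<in> U x" using D b(1) d(1) by blast
    have "V (b d) < V (b x)" using U(3) x D(1) b(1) d(1) by blast
    moreover have "V (b x) \<le> V (b d)" unfolding d(2) using D(2) x(1) by (intro Max_ge) auto
    ultimately show False by simp
  qed
  then show thesis using that by blast
qed

lemma usc_on_add:
  assumes "usc_on K V" "usc_on K W"
  shows "usc_on K (\<lambda>x. V x + W x)"
  unfolding usc_on_def
proof (intro ballI allI impI)
  fix x and e :: real assume x: "x \<in> K" and e: "e > 0"
  obtain A where A: "open A" "x \<in> A" "\<forall>y\<in>A \<inter> K. V y < V x + e / 2"
    using usc_onD[OF assms(1) x, of "V x + e / 2"] e by auto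
  obtain B where B: "open B" "x \<in> B" "\<forall>y\<in>B \<inter> K. W y < W x + e / 2"
    using usc_onD[OF assms(2) x, of "W x + e / 2"] e by auto
  have "V y + W y < V x + W x + e" if "y \<in> (A \<inter> B) \<inter> K" for y
  proof -
    have "V y < V x + e / 2" "W y < W x + e / 2" using A B that by auto
    then show ?thesis by simp
  qed
  then show "\<exists>U. open U \<and> x \<in> U \<and> (\<forall>y\<in>U \<inter> K. V y + W y < V x + W x + e)"
    using A B by (intro exI[of _ "A \<inter> B"]) auto
qed

lemma usc_on_const: "usc_on K (\<lambda>_. c)"
  unfolding usc_on_def by (auto intro: exI[of _ UNIV])

lemma usc_on_sum:
  assumes "\<And>i. i \<in> I \<Longrightarrow> usc_on K (V i)"
  shows "usc_on K (\<lambda>x. \<Sum>i\<in>I. V i x)"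
  using assms by (induction I rule: infinite_finite_induct) (auto intro: usc_on_add usc_on_const)

lemma usc_on_compose:
  assumes "usc_on S V" "continuous_on UNIV h" "h ` K \<subseteq> S"
  shows "usc_on K (\<lambda>x. V (h x))"
  unfolding usc_on_def
proof (intro ballI allI impI)
  fix x and e :: real assume x: "x \<in> K" and e: "e > 0"
  have "h x \<in> S" using x assms(3) by blast
  then obtain U where U: "open U" "h x \<in> U" "\<forall>y\<in>U \<inter> S. V y < V (h x) + e"
    using usc_onD[OF assms(1), of "h x" "V (h x) + e"] e by auto
  have "open (h -` U)" using assms(2) U(1) by (simp add: open_vimage)
  then show "\<exists>W. open W \<and> x \<in> W \<and> (\<forall>y\<in>W \<inter> K. V (h y) < V (h x) + e)"
    using U assms(3) by (intro exI[of _ "h -` U"]) auto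
qed

lemma tendsto_left_lim:
  assumes "cadlag g" "0 < x"
  shows "(g \<longlongrightarrow> left_lim g x) (at_left x)"
proof -
  obtain l where l: "(g \<longlongrightarrow> l) (at_left x)" using assms unfolding cadlag_def by blast
  then have "left_lim g x = l" using assms(2) by (simp add: left_lim_def tendsto_Lim)
  then show ?thesis using l by simp
qed

lemma left_lim_close:
  assumes "cadlag g" "0 < y" "x < y" and "\<And>z. x < z \<Longrightarrow> z < y \<Longrightarrow> \<bar>g z - c\<bar> < e"
  shows "\<bar>left_lim g y - c\<bar> \<le> e"
proof (rule tendsto_upperbound)
  show "((\<lambda>z. \<bar>g z - c\<bar>) \<longlongrightarrow> \<bar>left_lim g y - c\<bar>) (at_left y)"
    by (intro tendsto_intros tendsto_left_lim assms)
  show "\<forall>\<^sub>F z in at_left y. \<bar>g z - c\<bar> \<le> e"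
    unfolding eventually_at_left_field using assms(3,4) by (intro exI[of _ x]) (auto intro: less_imp_le)
qed simp

text \<open>
  Left limits taken at points near \<open>x\<close>, on one side of \<open>x\<close>, are close to the one-sided limit of \<open>g\<close> at \<open>x\<close>
  from that side.
\<close>
lemma cadlag_near:
  assumes g: "cadlag g" and x: "0 \<le> x" and e: "0 < e"
  obtains d where "0 < d"
    and "\<And>y. x \<le> y \<Longrightarrow> y < x + d \<Longrightarrow> \<bar>g y - g x\<bar> < e"
    and "\<And>y. x < y \<Longrightarrow> y < x + d \<Longrightarrow> \<bar>left_lim g y - g x\<bar> \<le> e"
    and "\<And>y. 0 \<le> y \<Longrightarrow> x - d < y \<Longrightarrow> y < x \<Longrightarrow> \<bar>g y - left_lim g x\<bar> < e"
    and "\<And>y. 0 \<le> y \<Longrightarrow> x - d < y \<Longrightarrow> y < x \<Longrightarrow> \<bar>left_lim g y - left_lim g x\<bar> \<le> e"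
proof -
  have "(g \<longlongrightarrow> g x) (at_right x)" using g x unfolding cadlag_def continuous_within by blast
  then have "\<forall>\<^sub>F y in at_right x. \<bar>g y - g x\<bar> < e"
    using e by (auto dest: tendstoD simp: dist_real_def)
  then obtain r where r: "x < r" "\<And>y. x < y \<Longrightarrow> y < r \<Longrightarrow> \<bar>g y - g x\<bar> < e"
    unfolding eventually_at_right_field by blast
  have "\<exists>l<x. \<forall>y. 0 \<le> y \<longrightarrow> l < y \<longrightarrow> y < x \<longrightarrow> 0 < y \<and> \<bar>g y - left_lim g x\<bar> < e"
  proof (cases "x = 0")
    case True
    then show ?thesis by (intro exI[of _ "-1"]) auto
  next
    case False
    then have "\<forall>\<^sub>F y in at_left x. \<bar>g y - left_lim g x\<bar> < e"
      using tendstoD[OF tendsto_left_lim[OF g], of x e] e x by (auto simp: dist_real_def)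
    then obtain l where "l < x" "\<And>y. l < y \<Longrightarrow> y < x \<Longrightarrow> \<bar>g y - left_lim g x\<bar> < e"
      unfolding eventually_at_left_field by blast
    then show ?thesis using False x by (intro exI[of _ "max l 0"]) auto
  qed
  then obtain l where l: "l < x" "\<And>y. 0 \<le> y \<Longrightarrow> l < y \<Longrightarrow> y < x \<Longrightarrow> 0 < y"
    "\<And>y. 0 \<le> y \<Longrightarrow> l < y \<Longrightarrow> y < x \<Longrightarrow> \<bar>g y - left_lim g x\<bar> < e" by blast
  show thesis
  proof (rule that[of "min (r - x) (x - l)"])
    show "0 < min (r - x) (x - l)" using r(1) l(1) by simp
    show "\<bar>g y - g x\<bar> < e" if "x \<le> y" "y < x + min (r - x) (x - l)" for y
      using r(2)[of y] that e by (cases "x = y") auto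
    show "\<bar>left_lim g y - g x\<bar> \<le> e" if "x < y" "y < x + min (r - x) (x - l)" for y
      by (rule left_lim_close[OF g _ that(1)]) (use r(2) that x in auto)
    show "\<bar>g y - left_lim g x\<bar> < e" if "0 \<le> y" "x - min (r - x) (x - l) < y" "y < x" for y
      using l(3)[of y] that by auto
    show "\<bar>left_lim g y - left_lim g x\<bar> \<le> e" if "0 \<le> y" "x - min (r - x) (x - l) < y" "y < x" for y
      by (rule left_lim_close[OF g, of _ "max l 0"]) (use l(2)[of y] l(3) that in auto)
  qed
qed

text \<open>
  In the third part, at a point with \<open>b = a = x\<close> the gap value is \<open>0\<close>.  For \<open>b' < a'\<close> near \<open>x\<close>, the value
  \<open>g b'\<close> and the left limit at \<open>a'\<close> are either close to the same one-sided limit of \<open>g\<close> at \<open>x\<close>, or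
  \<open>g b'\<close> is close to the limit from the left and the left limit at \<open>a'\<close> to \<open>g x\<close>, which is not smaller.
  So a gap that opens yields almost no gain.
\<close>
lemma usc_on_cadlag:
  assumes g: "cadlag g" and up: "\<And>x. 0 \<le> x \<Longrightarrow> left_lim g x \<le> g x"
  shows "usc_on {0..} g" and "usc_on {0..} (\<lambda>x. - left_lim g x)"
    and "usc_on {(b, a). 0 \<le> b \<and> b \<le> a} (\<lambda>(b, a). gap_value g b a)"
proof -
  have *: "\<exists>d>0. (\<forall>y\<ge>0. \<bar>y - x\<bar> < d \<longrightarrow> g y < g x + e) \<and>
      (\<forall>y\<ge>0. \<bar>y - x\<bar> < d \<longrightarrow> left_lim g x - e < left_lim g y) \<and>
      (\<forall>b\<ge>0. \<forall>a>b. \<bar>b - x\<bar> < d \<longrightarrow> \<bar>a - x\<bar> < d \<longrightarrow> g b - left_lim g a < e)"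
    if x: "0 \<le> x" and e: "0 < e" for x e :: real
  proof -
    define r where "r = e / 3"
    have r: "0 < r" "3 * r = e" using e by (simp_all add: r_def)
    from cadlag_near[OF g x r(1)] obtain d where d: "0 < d"
      and rg: "\<And>y. x \<le> y \<Longrightarrow> y < x + d \<Longrightarrow> \<bar>g y - g x\<bar> < r"
      and rl: "\<And>y. x < y \<Longrightarrow> y < x + d \<Longrightarrow> \<bar>left_lim g y - g x\<bar> \<le> r"
      and lg: "\<And>y. 0 \<le> y \<Longrightarrow> x - d < y \<Longrightarrow> y < x \<Longrightarrow> \<bar>g y - left_lim g x\<bar> < r"
      and ll: "\<And>y. 0 \<le> y \<Longrightarrow> x - d < y \<Longrightarrow> y < x \<Longrightarrow> \<bar>left_lim g y - left_lim g x\<bar> \<le> r"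
      by blast
    have U: "g y < g x + r" if "0 \<le> y" "\<bar>y - x\<bar> < d" for y
      using rg[of y] lg[of y] up[OF x] that by (cases "x \<le> y") auto
    have L: "left_lim g x - 2 * r < left_lim g y" if "0 \<le> y" "\<bar>y - x\<bar> < d" for y
      using rl[of y] ll[of y] up[OF x] that r by (cases x y rule: linorder_cases) auto
    have G: "g b - left_lim g a < e" if "0 \<le> b" "b < a" "\<bar>b - x\<bar> < d" "\<bar>a - x\<bar> < d" for a b
    proof (cases "b < x")
      case True
      then show ?thesis using lg[of b] L[of a] that r by auto
    next
      case False
      then show ?thesis using rg[of b] rl[of a] that r by auto
    qed
    show ?thesis
    proof (intro exI[of _ d] conjI allI impI)
      show "g y < g x + e" if "0 \<le> y" "\<bar>y - x\<bar> < d" for y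
        using U[OF that] r by linarith
      show "left_lim g x - e < left_lim g y" if "0 \<le> y" "\<bar>y - x\<bar> < d" for y
        using L[OF that] r by linarith
    qed (use d G in auto)
  qed
  have ball: "open (ball x d)" "y \<in> ball x d \<longleftrightarrow> \<bar>y - x\<bar> < d" for x y d :: real
    by (auto simp: dist_real_def)
  show "usc_on {0..} g"
    unfolding usc_on_def
  proof (intro ballI allI impI)
    fix x e :: real assume "x \<in> {0..}" "0 < e"
    then obtain d where "d > 0" "\<forall>y\<ge>0. \<bar>y - x\<bar> < d \<longrightarrow> g y < g x + e" using *[of x e] by auto
    then show "\<exists>U. open U \<and> x \<in> U \<and> (\<forall>y\<in>U \<inter> {0..}. g y < g x + e)"
      using ball by (intro exI[of _ "ball x d"]) auto
  qed
  show "usc_on {0..} (\<lambda>x. - left_lim g x)"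
    unfolding usc_on_def
  proof (intro ballI allI impI)
    fix x e :: real assume "x \<in> {0..}" "0 < e"
    then obtain d where "d > 0" "\<forall>y\<ge>0. \<bar>y - x\<bar> < d \<longrightarrow> left_lim g x - e < left_lim g y"
      using *[of x e] by auto
    then show "\<exists>U. open U \<and> x \<in> U \<and> (\<forall>y\<in>U \<inter> {0..}. - left_lim g y < - left_lim g x + e)"
      using ball by (intro exI[of _ "ball x d"]) force
  qed
  show "usc_on {(b, a). 0 \<le> b \<and> b \<le> a} (\<lambda>(b, a). gap_value g b a)"
    unfolding usc_on_def
  proof (intro ballI allI impI)
    fix z :: "real \<times> real" and e :: real
    assume z: "z \<in> {(b, a). 0 \<le> b \<and> b \<le> a}" and e: "0 < e"
    obtain b a where ba: "z = (b, a)" "0 \<le> b" "b \<le> a" using z by auto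
    show "\<exists>U. open U \<and> z \<in> U \<and> (\<forall>y\<in>U \<inter> {(b, a). 0 \<le> b \<and> b \<le> a}.
      (case y of (b, a) \<Rightarrow> gap_value g b a) < (case z of (b, a) \<Rightarrow> gap_value g b a) + e)"
    proof (cases "b = a")
      case True
      obtain d where d: "d > 0"
        "\<forall>b'\<ge>0. \<forall>a'>b'. \<bar>b' - b\<bar> < d \<longrightarrow> \<bar>a' - b\<bar> < d \<longrightarrow> g b' - left_lim g a' < e"
        using *[OF ba(2) e] by auto
      show ?thesis
        using d ball e True ba
        by (intro exI[of _ "ball b d \<times> ball b d"]) (auto intro!: open_Times simp: gap_value_def)
    next
      case False
      \<comment> \<open>Keeping the two coordinates on different sides of \<open>c\<close> preserves the strict inequality.\<close>
      define c where "c = (b + a) / 2"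
      have c: "b < c" "c < a" using False ba(3) unfolding c_def by auto
      obtain d where d: "d > 0" "\<forall>y\<ge>0. \<bar>y - b\<bar> < d \<longrightarrow> g y < g b + e / 2"
        using *[OF ba(2), of "e / 2"] e by auto
      obtain d' where d': "d' > 0" "\<forall>y\<ge>0. \<bar>y - a\<bar> < d' \<longrightarrow> left_lim g a - e / 2 < left_lim g y"
        using *[of a "e / 2"] e ba by auto
      let ?U = "(ball b d \<inter> {..<c}) \<times> (ball a d' \<inter> {c<..})"
      have "gap_value g y x < gap_value g b a + e"
        if "(y, x) \<in> ?U" "0 \<le> y" for y x
      proof -
        have "y < x" "g y < g b + e / 2" "left_lim g a - e / 2 < left_lim g x"
          using that d(2) d'(2) ball c ba(2) by auto
        then show ?thesis using False ba(3) by (simp add: gap_value_def)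
      qed
      moreover have "open ?U" by (intro open_Times open_Int) auto
      moreover have "z \<in> ?U" using ba(1) d(1) d'(1) c by simp
      ultimately show ?thesis using ba(1) by (intro exI[of _ ?U]) auto
    qed
  qed
qed

lemma compact_Collect_range:
  "compact {\<tau> :: nat \<Rightarrow> nat \<Rightarrow> real. \<forall>i j. 0 \<le> \<tau> i j \<and> \<tau> i j \<le> t}"
proof -
  have 1: "compact (PiE UNIV (\<lambda>_::nat. {0..t}))"
    using compactin_PiE[of "\<lambda>_. euclidean" UNIV "\<lambda>_::nat. {0..t}"]
    by (simp add: euclidean_product_topology)
  have "compact (PiE UNIV (\<lambda>_::nat. PiE UNIV (\<lambda>_::nat. {0..t})))"
    using 1 compactin_PiE[of "\<lambda>_. euclidean" UNIV "\<lambda>_::nat. PiE UNIV (\<lambda>_::nat. {0..t})"]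
    by (simp add: euclidean_product_topology)
  also have "PiE UNIV (\<lambda>_::nat. PiE UNIV (\<lambda>_::nat. {0..t})) = {\<tau>. \<forall>i j. 0 \<le> \<tau> i j \<and> \<tau> i j \<le> t}"
    by (auto simp: PiE_iff)
  finally show ?thesis .
qed

lemma continuous_on_array_entry: "continuous_on UNIV (\<lambda>\<tau> :: nat \<Rightarrow> nat \<Rightarrow> real. \<tau> i j)"
  using continuous_on_product_then_coordinatewise[OF continuous_on_product_coordinates] .

lemma closed_Collect_ball:
  assumes "\<And>i. i \<in> I \<Longrightarrow> closed {x. P i x}"
  shows "closed {x. \<forall>i\<in>I. P i x}"
proof -
  have "{x. \<forall>i\<in>I. P i x} = (\<Inter>i\<in>I. {x. P i x})" by auto
  then show ?thesis using assms by auto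
qed

lemma compact_switch_arrays: "compact {\<tau>. switch_array n k t \<tau>}"
proof -
  have "closed {\<tau>. (\<forall>i\<in>{1..k}. \<tau> i n = 0 \<and> \<tau> i 0 = t \<and> (\<forall>j\<in>{1..n}. \<tau> i j \<le> \<tau> i (j - 1))) \<and>
     (\<forall>i\<in>{1..<k}. \<forall>j\<in>{1..n}. \<tau> i (j - 1) \<le> \<tau> (Suc i) j)}"
    by (intro closed_Collect_conj closed_Collect_ball closed_Collect_le closed_Collect_eq
        continuous_on_array_entry continuous_on_const)
  from compact_Int_closed[OF compact_Collect_range[of t] this] show ?thesis
    unfolding switch_array_def Collect_conj_eq[symmetric] .
qed

lemma usc_on_array_value:
  assumes f: "f \<in> Dspace n" and k: "1 \<le> k"
  shows "usc_on {\<tau>. switch_array n k t \<tau>} (array_value n f k)"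
  unfolding array_value_def
proof (rule usc_on_sum)
  fix j assume j: "j \<in> {1..n}"
  have g: "cadlag (f j)" "\<And>x. 0 \<le> x \<Longrightarrow> left_lim (f j) x \<le> f j x"
    using f j unfolding Dspace_def by auto
  note usc = usc_on_cadlag[OF g]
  let ?K = "{\<tau>. switch_array n k t \<tau>}"
  have "usc_on ?K (\<lambda>\<tau>. f j (\<tau> k (j - 1)))"
    by (rule usc_on_compose[OF usc(1) continuous_on_array_entry]) (auto simp: switch_arrayD(1))
  moreover have "usc_on ?K (\<lambda>\<tau>. - left_lim (f j) (\<tau> 1 j))"
    by (rule usc_on_compose[OF usc(2) continuous_on_array_entry]) (auto simp: switch_arrayD(1))
  moreover have "usc_on ?K (\<lambda>\<tau>. gap_value (f j) (\<tau> i (j - 1)) (\<tau> (Suc i) j))" if i: "i \<in> {1..<k}" for i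
  proof -
    have "usc_on ?K (\<lambda>\<tau>. (\<lambda>(b, a). gap_value (f j) b a) (\<tau> i (j - 1), \<tau> (Suc i) j))"
      by (rule usc_on_compose[OF usc(3)])
        (use switch_arrayD(1,6) i j in \<open>auto intro!: continuous_on_Pair continuous_on_array_entry\<close>)
    then show ?thesis by simp
  qed
  ultimately have "usc_on ?K (\<lambda>\<tau>. (f j (\<tau> k (j - 1)) + - left_lim (f j) (\<tau> 1 j))
      + (\<Sum>i\<in>{1..<k}. gap_value (f j) (\<tau> i (j - 1)) (\<tau> (Suc i) j)))"
    by (intro usc_on_add usc_on_sum)
  then show "usc_on ?K (\<lambda>\<tau>. chain_value (f j) k (\<lambda>i. \<tau> i j) (\<lambda>i. \<tau> i (j - 1)))"
    unfolding chain_value_def by simp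
qed

lemma optimal_switch_array:
  assumes f: "f \<in> Dspace n" and k: "1 \<le> k" "k \<le> n" and t: "0 \<le> t"
  obtains \<tau> where "switch_array n k t \<tau>"
    "\<And>\<sigma>. switch_array n k t \<sigma> \<Longrightarrow> array_value n f k \<sigma> \<le> array_value n f k \<tau>"
proof -
  \<comment> \<open>The array of the constant paths on lines \<open>1, \<dots>, k\<close>.\<close>
  have "switch_array n k t (\<lambda>i j. if i \<le> j then 0 else t)"
    using k t unfolding switch_array_def by auto
  then have ne: "{\<tau>. switch_array n k t \<tau>} \<noteq> {}" by blast
  show thesis
  proof (rule usc_on_attains_max[OF compact_switch_arrays ne usc_on_array_value[OF f k(1)]])
    fix \<tau> assume \<tau>: "\<tau> \<in> {\<tau>. switch_array n k t \<tau>}"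
      and max: "\<And>\<sigma>. \<sigma> \<in> {\<tau>. switch_array n k t \<tau>} \<Longrightarrow> array_value n f k \<sigma> \<le> array_value n f k \<tau>"
    show thesis using \<tau> max by (intro that[of \<tau>]) simp_all
  qed
qed

lemma stairs_disjoint_optimizer:
  assumes k: "1 \<le> k" and S: "switch_array n k t \<tau>"
    and opt: "\<And>\<sigma>. switch_array n k t \<sigma> \<Longrightarrow> array_value n f k \<sigma> \<le> array_value n f k \<tau>"
  shows "disjoint_optimizer n f k t (\<lambda>i. stair n (\<tau> i))"
  unfolding disjoint_optimizer_def
proof (intro conjI ballI impI)
  show "disjoint_paths n k t (\<lambda>i. stair n (\<tau> i))" by (rule stairs_disjoint_paths[OF S])
  show "left_of (stair n (\<tau> i)) (stair n (\<tau> j))" if "i \<in> {1..k}" "j \<in> {1..k}" "i < j" for i j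
    using stairs_left_of[OF S] that by auto
  have "last_passage n f k t = df n f (\<Union>i\<in>{1..k}. stair n (\<tau> i))"
    unfolding last_passage_def
  proof (rule cSup_eq_maximum)
    show "df n f (\<Union>i\<in>{1..k}. stair n (\<tau> i)) \<in> (\<lambda>p. df n f (\<Union>i\<in>{1..k}. p i)) ` {p. disjoint_paths n k t p}"
      using stairs_disjoint_paths[OF S] by blast
  next
    fix v assume "v \<in> (\<lambda>p. df n f (\<Union>i\<in>{1..k}. p i)) ` {p. disjoint_paths n k t p}"
    then obtain p where p: "disjoint_paths n k t p" "v = df n f (\<Union>i\<in>{1..k}. p i)" by blast
    obtain \<sigma> where \<sigma>: "switch_array n k t \<sigma>" "(\<Union>i\<in>{1..k}. stair n (\<sigma> i)) = (\<Union>i\<in>{1..k}. p i)"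
      using disjoint_paths_sorted[OF p(1) k] .
    show "v \<le> df n f (\<Union>i\<in>{1..k}. stair n (\<tau> i))"
      using opt[OF \<sigma>(1)] df_stairs[OF \<sigma>(1) k] df_stairs[OF S k] p(2) \<sigma>(2) by simp
  qed
  then show "df n f (\<Union>i\<in>{1..k}. stair n (\<tau> i)) = last_passage n f k t" by simp
qed

section \<open>Pushing an optimizer towards record times\<close>

definition record_time :: "(real \<Rightarrow> real) \<Rightarrow> real \<Rightarrow> bool" where
  "record_time h u \<longleftrightarrow> (\<forall>s\<in>{0..u}. h s \<le> h u)"

text \<open>
  A maximum point on a large interval \<open>[0, y]\<close> is a record time, and it lies beyond \<open>M\<close> as soon as \<open>h y\<close>
  exceeds the maximum of \<open>h\<close> on \<open>[0, M]\<close>.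
\<close>
lemma usc_unbounded_late_record:
  assumes usc: "usc_on {0..} h" and unb: "\<And>B. \<exists>x\<ge>0. B < h x" and M: "0 \<le> M"
  shows "\<exists>u>M. record_time h u"
proof -
  have att: "\<exists>u\<in>{0..m}. \<forall>s\<in>{0..m}. h s \<le> h u" if "0 \<le> m" for m
  proof -
    have "usc_on {0..m} h"
      using usc_on_compose[OF usc continuous_on_id, of "{0..m}"] by auto
    moreover have "{0..m} \<noteq> {}" using that by simp
    ultimately show ?thesis using usc_on_attains_max[OF compact_Icc] by metis
  qed
  obtain u0 where u0: "u0 \<in> {0..M}" "\<forall>s\<in>{0..M}. h s \<le> h u0" using att[OF M] by blast
  obtain y where y: "0 \<le> y" "h u0 < h y" using unb by blast
  obtain u where u: "u \<in> {0..y}" "\<forall>s\<in>{0..y}. h s \<le> h u" using att[OF y(1)] by blast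
  have "h y \<le> h u" using y(1) u(2) by simp
  then have "h u0 < h u" using y(2) by simp
  then have "M < u" using u0(2) u(1) by (meson atLeastAtMost_iff leD not_le_imp_less)
  moreover have "record_time h u" using u unfolding record_time_def by auto
  ultimately show ?thesis by blast
qed

lemma switch_gain_late_record:
  assumes f: "f \<in> Dspace n" and j: "j \<in> {1..<n}" and M: "0 \<le> M"
    and unb: "\<not> bounded ((\<lambda>x. max (f (j + 1) x - f j x) 0) ` {0..})"
  shows "\<exists>u>M. record_time (switch_gain f j) u"
proof (rule usc_unbounded_late_record[OF _ _ M])
  have "usc_on {0..} (f (Suc j))" "usc_on {0..} (\<lambda>x. - left_lim (f j) x)"
    using f j unfolding Dspace_def by (auto intro!: usc_on_cadlag)
  from usc_on_add[OF this] show "usc_on {0..} (switch_gain f j)"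
    unfolding switch_gain_def by simp
next
  fix B
  show "\<exists>x\<ge>0. B < switch_gain f j x"
  proof (rule ccontr)
    assume neg: "\<not> (\<exists>x\<ge>0. B < switch_gain f j x)"
    have "\<bar>max (f (j + 1) x - f j x) 0\<bar> \<le> max B 0" if "0 \<le> x" for x
    proof -
      have "left_lim (f j) x \<le> f j x" using f j that unfolding Dspace_def by auto
      moreover have "switch_gain f j x \<le> B" using neg that by (auto simp: not_less)
      ultimately show ?thesis unfolding switch_gain_def by auto
    qed
    then show False using unb unfolding bounded_iff by (auto simp del: max.bounded_iff)
  qed
qed

text \<open>
  The pairs \<open>(i, j)\<close> with \<open>j \<le> n\<close> are ranked by \<open>i * (n + 1) + (n - j)\<close>: the rank determines the pair, and
  the rank of \<open>(i, j)\<close> is below that of \<open>(i, j - 1)\<close>, which is below that of \<open>(i + 1, j)\<close>.  Times increasing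
  strictly with the rank therefore satisfy all conditions on the order of the entries of an array
  strictly.  The maximum is only taken at entries that are not forced to be \<open>0\<close>.  It does not lower any
  gain, because the new times are record times.  It creates no touching times: if
  \<open>\<sigma> i (j - 1) = \<sigma> (i + 1) j\<close> for such entries, this common time is later than the one prescribed for \<open>(i, j - 1)\<close>, so it is
  the old \<open>\<tau> i (j - 1)\<close>, and \<open>\<tau> (i + 1) j\<close> is squeezed between the two.
\<close>
lemma max_switch_array:
  assumes S: "switch_array n k t \<tau>" and k: "1 \<le> k" "k \<le> n"
    and u: "strict_mono u" "\<And>q. 0 \<le> u q" "\<And>q. q < (k + 1) * (n + 1) \<Longrightarrow> u q \<le> t"
    and rec: "\<And>i j. i \<in> {1..k} \<Longrightarrow> j \<in> {1..<n} \<Longrightarrow> record_time (switch_gain f j) (u (i * (n + 1) + (n - j)))"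
    and f: "f \<in> Dspace n"
  defines "\<sigma> \<equiv> \<lambda>i j. if i \<in> {1..k} \<and> j < n - k + i then max (\<tau> i j) (u (i * (n + 1) + (n - j))) else \<tau> i j"
  shows "switch_array n k t \<sigma>" and "array_value n f k \<tau> \<le> array_value n f k \<sigma>"
proof -
  have rank: "u (i * (n + 1) + (n - j)) < u (i * (n + 1) + (n - (j - 1)))" if "j \<in> {1..n}" for i j
    by (rule strict_monoD[OF u(1)]) (use that in auto)
  have rank': "u (i * (n + 1) + (n - (j - 1))) < u (Suc i * (n + 1) + (n - j))" if "j \<in> {1..n}" for i j
    by (rule strict_monoD[OF u(1)]) (use that k in auto)
  have ut: "u (i * (n + 1) + (n - j)) \<le> t" if "i \<in> {1..k}" for i j
  proof (rule u(3))
    have "i * (n + 1) \<le> k * (n + 1)" using that by (intro mult_le_mono) auto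
    then show "i * (n + 1) + (n - j) < (k + 1) * (n + 1)" by simp
  qed
  show S': "switch_array n k t \<sigma>"
    unfolding switch_array_def
  proof (intro conjI allI ballI)
    show "0 \<le> \<sigma> i j" "\<sigma> i j \<le> t" for i j
      using switch_arrayD(1,2)[OF S, of i j] ut[of i j] unfolding \<sigma>_def by auto
    show "\<sigma> i n = 0" if "i \<in> {1..k}" for i
      using switch_arrayD(3)[OF S that] that k unfolding \<sigma>_def by auto
    show "\<sigma> i 0 = t" if "i \<in> {1..k}" for i
      using switch_arrayD(4)[OF S that] ut[OF that, of 0] unfolding \<sigma>_def by auto
    show "\<sigma> i j \<le> \<sigma> i (j - 1)" if "i \<in> {1..k}" "j \<in> {1..n}" for i j
      using switch_arrayD(5)[OF S that] rank[OF that(2), of i] that unfolding \<sigma>_def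
      by (auto simp: max_def)
    show "\<sigma> i (j - 1) \<le> \<sigma> (Suc i) j" if "i \<in> {1..<k}" "j \<in> {1..n}" for i j
      using switch_arrayD(6)[OF S that] rank'[OF that(2), of i] that unfolding \<sigma>_def
      by (auto simp: max_def)
  qed
  have gain: "switch_gain f j (\<tau> i j) \<le> switch_gain f j (\<sigma> i j)" if "i \<in> {1..k}" "j \<in> {1..<n}" for i j
    using rec[OF that] switch_arrayD(1)[OF S, of i j]
    unfolding \<sigma>_def record_time_def by (auto simp: max_def)
  have touch: "\<sigma> i (j - 1) = \<tau> i (j - 1) \<and> \<tau> i (j - 1) = \<tau> (Suc i) j"
    if "i \<in> {1..<k}" "j \<in> {1..n}" "\<sigma> i (j - 1) = \<sigma> (Suc i) j" for i j
    using switch_arrayD(6)[OF S that(1,2)] rank'[OF that(2), of i] that unfolding \<sigma>_def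
    by (auto simp: max_def split: if_splits)
  have jump: "left_lim (f j) (\<tau> i l) \<le> f j (\<tau> i l)" if "j \<in> {1..n}" for i j l
    using f that switch_arrayD(1)[OF S] unfolding Dspace_def by auto
  have n: "1 \<le> n" using k by simp
  have "(\<Sum>i\<in>{1..k}. \<Sum>j\<in>{1..<n}. switch_gain f j (\<tau> i j)) \<le> (\<Sum>i\<in>{1..k}. \<Sum>j\<in>{1..<n}. switch_gain f j (\<sigma> i j))"
    by (intro sum_mono gain)
  moreover have "(\<Sum>j\<in>{1..n}. \<Sum>i\<in>{1..<k}. if \<sigma> i (j - 1) = \<sigma> (Suc i) j
        then f j (\<sigma> i (j - 1)) - left_lim (f j) (\<sigma> i (j - 1)) else 0)
    \<le> (\<Sum>j\<in>{1..n}. \<Sum>i\<in>{1..<k}. if \<tau> i (j - 1) = \<tau> (Suc i) j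
        then f j (\<tau> i (j - 1)) - left_lim (f j) (\<tau> i (j - 1)) else 0)"
  proof (intro sum_mono)
    fix j i assume j: "j \<in> {1..n}" and i: "i \<in> {1..<k}"
    show "(if \<sigma> i (j - 1) = \<sigma> (Suc i) j then f j (\<sigma> i (j - 1)) - left_lim (f j) (\<sigma> i (j - 1)) else 0)
      \<le> (if \<tau> i (j - 1) = \<tau> (Suc i) j then f j (\<tau> i (j - 1)) - left_lim (f j) (\<tau> i (j - 1)) else 0)"
    proof (cases "\<sigma> i (j - 1) = \<sigma> (Suc i) j")
      case True
      show ?thesis using True touch[OF i j True] by simp
    next
      case False
      then show ?thesis using jump[OF j, of i "j - 1"] by auto
    qed
  qed
  ultimately show "array_value n f k \<tau> \<le> array_value n f k \<sigma>"
    unfolding array_value_eq_switch_gains[OF S k(1) n] array_value_eq_switch_gains[OF S' k(1) n] by linarith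
qed

lemma late_optimizer:
  assumes f: "f \<in> Dspace n" and k: "k \<in> {1..n}" and T: "0 \<le> T"
    and unb: "\<forall>j\<in>{1..n-1}. \<not> bounded ((\<lambda>x. max (f (j + 1) x - f j x) 0) ` {0..})"
  shows "\<exists>t\<ge>T. \<exists>p. disjoint_optimizer n f k t p \<and> (\<forall>i\<in>{1..k}. {0..T} \<times> {n - k + i} \<subseteq> p i)"
proof -
  have k': "1 \<le> k" "k \<le> n" using k by auto
  \<comment> \<open>The second index of the pair with rank \<open>q\<close>; gains only exist for values from \<open>1\<close> to \<open>n - 1\<close>.\<close>
  define line where "line q = n - q mod (n + 1)" for q
  define P where "P q x \<longleftrightarrow> T \<le> x \<and> (line q \<in> {1..<n} \<longrightarrow> record_time (switch_gain f (line q)) x)" for q x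
  have next_time: "\<exists>y. P q y \<and> x < y" if "T \<le> x" for q x
  proof (cases "line q \<in> {1..<n}")
    case True
    then have "\<not> bounded ((\<lambda>x. max (f (line q + 1) x - f (line q) x) 0) ` {0..})" using unb by auto
    then obtain y where "x < y" "record_time (switch_gain f (line q)) y"
      using switch_gain_late_record[OF f True, of x] T \<open>T \<le> x\<close> by auto
    then show ?thesis
      using \<open>T \<le> x\<close> unfolding P_def by (intro exI[of _ y]) auto
  next
    case False
    then show ?thesis using that unfolding P_def by (intro exI[of _ "x + 1"]) auto
  qed
  have "\<exists>u. \<forall>q. P q (u q) \<and> u q < u (Suc q)"
  proof (rule dependent_nat_choice)
    show "\<exists>x. P 0 x" using next_time[of T 0] by auto
    show "\<exists>y. P (Suc q) y \<and> x < y" if "P q x" for x q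
      using next_time that unfolding P_def by blast
  qed
  then obtain u where u: "\<And>q. P q (u q)" "\<And>q. u q < u (Suc q)" by blast
  have mono: "strict_mono u" using u(2) by (simp add: strict_mono_Suc_iff)
  have Tu: "T \<le> u q" for q using u(1) unfolding P_def by blast
  define t where "t = u ((k + 1) * (n + 1))"
  have ut: "u q \<le> t" if "q < (k + 1) * (n + 1)" for q
    unfolding t_def using strict_monoD[OF mono that] by simp
  have rec: "record_time (switch_gain f j) (u (i * (n + 1) + (n - j)))" if "j \<in> {1..<n}" for i j
  proof -
    have "(i * (n + 1) + (n - j)) mod (n + 1) = n - j"
      by (subst mod_mult_self3) simp
    then have "line (i * (n + 1) + (n - j)) = j" using that unfolding line_def by auto
    then show ?thesis using u(1)[of "i * (n + 1) + (n - j)"] that unfolding P_def by simp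
  qed
  have t: "T \<le> t" "0 \<le> t" using Tu[of "(k + 1) * (n + 1)"] T unfolding t_def by linarith+
  obtain \<tau> where \<tau>: "switch_array n k t \<tau>"
    "\<And>\<sigma>. switch_array n k t \<sigma> \<Longrightarrow> array_value n f k \<sigma> \<le> array_value n f k \<tau>"
    using optimal_switch_array[OF f k' t(2)] by blast
  define \<sigma> where "\<sigma> = (\<lambda>i j. if i \<in> {1..k} \<and> j < n - k + i
    then max (\<tau> i j) (u (i * (n + 1) + (n - j))) else \<tau> i j)"
  have u0: "0 \<le> u q" for q using Tu[of q] T by linarith
  have \<sigma>: "switch_array n k t \<sigma>" "array_value n f k \<tau> \<le> array_value n f k \<sigma>"
    unfolding \<sigma>_def by (rule max_switch_array[OF \<tau>(1) k' mono u0 ut rec f]; assumption)+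
  have "disjoint_optimizer n f k t (\<lambda>i. stair n (\<sigma> i))"
    by (rule stairs_disjoint_optimizer[OF k'(1) \<sigma>(1)]) (rule order_trans[OF \<tau>(2) \<sigma>(2)])
  moreover have "{0..T} \<times> {n - k + i} \<subseteq> stair n (\<sigma> i)" if i: "i \<in> {1..k}" for i
  proof -
    have "\<sigma> i (n - k + i) = 0"
      using switch_array_eq_0[OF \<sigma>(1) i] i k' by auto
    moreover have "T \<le> \<sigma> i (n - k + i - 1)"
    proof -
      have "n - k + i - 1 < n - k + i" using i by auto
      then have "u (i * (n + 1) + (n - (n - k + i - 1))) \<le> \<sigma> i (n - k + i - 1)"
        using i unfolding \<sigma>_def by simp
      then show ?thesis using Tu order_trans by blast
    qed
    ultimately show ?thesis
      using i k' by (auto simp: mem_stair)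
  qed
  ultimately have "\<exists>p. disjoint_optimizer n f k t p \<and> (\<forall>i\<in>{1..k}. {0..T} \<times> {n - k + i} \<subseteq> p i)"
    by (intro exI[of _ "\<lambda>i. stair n (\<sigma> i)"] conjI ballI)
  with t(1) show ?thesis by (intro exI[of _ t] conjI)
qed

section \<open>Membership in the closure\<close>

theorem proposition1p3:
  fixes n :: nat and f :: "nat \<Rightarrow> real \<Rightarrow> real"
  assumes "f \<in> Dspace n"
    and "\<forall>j\<in>{1..n-1}. \<not> bounded ((\<lambda>x. max (f (j + 1) x - f j x) 0) ` {0..})"
  shows "f \<in> Dspace_down n"
proof -
  have "f \<in> Dspace_down_minus n"
    unfolding Dspace_down_minus_def
  proof (intro CollectI conjI ballI assms(1))
    fix k assume k: "k \<in> {1..n}"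
    have "\<forall>m. \<exists>t. \<exists>p. real m \<le> t \<and> disjoint_optimizer n f k t p \<and>
        (\<forall>i\<in>{1..k}. {0..real m} \<times> {n - k + i} \<subseteq> p i)"
      using late_optimizer[OF assms(1) k _ assms(2)] by (meson of_nat_0_le_iff)
    then obtain t p where tp: "\<And>m. real m \<le> t m" "\<And>m. disjoint_optimizer n f k (t m) (p m)"
      "\<And>m i. i \<in> {1..k} \<Longrightarrow> {0..real m} \<times> {n - k + i} \<subseteq> p m i"
      unfolding choice_iff by blast
    have "filterlim t at_top sequentially"
      by (rule filterlim_at_top_mono[OF filterlim_real_sequentially]) (simp add: tp(1))
    moreover have "\<forall>\<^sub>F m in sequentially. \<forall>i\<in>{1..k}. {0..T} \<times> {n - k + i} \<subseteq> p m i" for T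
    proof -
      have "\<forall>\<^sub>F m in sequentially. T \<le> real m"
        using filterlim_real_sequentially unfolding filterlim_at_top by blast
      then show ?thesis
      proof eventually_elim
        case (elim m)
        then have "{0..T} \<subseteq> {0..real m}" by auto
        then show ?case using tp(3)[of _ m] by blast
      qed
    qed
    ultimately show "\<exists>t p. filterlim t at_top sequentially \<and> (\<forall>m. disjoint_optimizer n f k (t m) (p m)) \<and>
       (\<forall>T>0. \<forall>\<^sub>F m in sequentially. \<forall>i\<in>{1..k}. {0..T} \<times> {n - k + i} \<subseteq> p m i)"
      using tp(2) by blast
  qed
  moreover have "Dspace_down_minus n \<subseteq> topspace (uniform_topology n)"
    unfolding topspace_uniform_topology Dspace_down_minus_def by blast
  ultimately show ?thesis
    unfolding Dspace_down_def using closure_of_subset by blast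
qed

end
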